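(* Let $R$ be a Noetherian ring and $n>0$ an integer. Let $M$ be a left $R$-module of projective dimension at most $n$ and let $N\subseteq M$ be a countably generated sub-module of $M$. Then there exists a $\mathcal{P}_n^{\aleph_0}$-filtration $(M_\alpha : \alpha<\lambda)$ of $M$, with $\lambda>1$, such that $M_1\in\mathcal{P}_n^{\aleph_0}$ and $N\subseteq M_1$.
   Context: $\mathcal{P}_n^{\aleph_0}$ denotes the set (of representatives) of all left $R$-modules $M$ having an exact sequence $0\to\bigoplus_{i\in I_n}P_n^i\to\cdots\to\bigoplus_{i\in I_1}P_1^i\to\bigoplus_{i\in I_0}P_0^i\to M\to 0$ in which every $P_k^i$ is a countably generated projective module and every index set $I_k$ ($0\leq k\leq n$) is countable. Given a class $\mathcal{S}$ of objects of a cocomplete Abelian category, an $\mathcal{S}$-filtration of an object $X$ is a family $(X_\alpha:\alpha<\lambda)$, $\lambda$ an ordinal, forming a colimit-preserving functor on $\lambda$ (so $X_\beta=\mathrm{CoLim}_{\alpha<\beta}X_\alpha$ for limit ordinals $\beta<\lambda$), with $X=\mathrm{CoLim}_{\alpha<\lambda}X_\alpha$, such that $X_0\in\mathcal{S}$ and for each $\alpha+1<\lambda$ the map $X_\alpha\to X_{\alpha+1}$ is a monomorphism with cokernel in $\mathcal{S}$. *)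

theory Defs
  imports "HOL.Hull" "HOL-Algebra.Module" "HOL-Algebra.AbelCoset" "HOL-Library.Countable_Set"
begin

section \<open>Left modules over a not necessarily commutative ring\<close>

text \<open>The library locale \<^locale>\<open>module\<close> requires a commutative ring of scalars; the axioms here are
  otherwise the same. The record type \<^type>\<open>module\<close> and the locale \<^locale>\<open>submodule\<close> of the
  library do not mention commutativity and are used as they are. (The fields \<open>mult\<close> and \<open>one\<close> of
  the record play no role for modules.)\<close>

locale left_module = R?: ring R + M?: abelian_group M
  for R :: "('a, 'r) ring_scheme" (structure) and M :: "('a, 'm, 'n) module_scheme" (structure) +
  assumes smult_closed [simp, intro]:
      "\<lbrakk>a \<in> carrier R; x \<in> carrier M\<rbrakk> \<Longrightarrow> a \<odot>\<^bsub>M\<^esub> x \<in> carrier M"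
    and smult_l_distr:
      "\<lbrakk>a \<in> carrier R; b \<in> carrier R; x \<in> carrier M\<rbrakk> \<Longrightarrow>
        (a \<oplus> b) \<odot>\<^bsub>M\<^esub> x = a \<odot>\<^bsub>M\<^esub> x \<oplus>\<^bsub>M\<^esub> b \<odot>\<^bsub>M\<^esub> x"
    and smult_r_distr:
      "\<lbrakk>a \<in> carrier R; x \<in> carrier M; y \<in> carrier M\<rbrakk> \<Longrightarrow>
        a \<odot>\<^bsub>M\<^esub> (x \<oplus>\<^bsub>M\<^esub> y) = a \<odot>\<^bsub>M\<^esub> x \<oplus>\<^bsub>M\<^esub> a \<odot>\<^bsub>M\<^esub> y"
    and smult_assoc1:
      "\<lbrakk>a \<in> carrier R; b \<in> carrier R; x \<in> carrier M\<rbrakk> \<Longrightarrow>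
        (a \<otimes> b) \<odot>\<^bsub>M\<^esub> x = a \<odot>\<^bsub>M\<^esub> (b \<odot>\<^bsub>M\<^esub> x)"
    and smult_one [simp]:
      "x \<in> carrier M \<Longrightarrow> \<one> \<odot>\<^bsub>M\<^esub> x = x"

definition left_module_hom ::
    "('a, 'r) ring_scheme \<Rightarrow> ('a, 'b) module \<Rightarrow> ('a, 'c) module \<Rightarrow> ('b \<Rightarrow> 'c) set" where
  "left_module_hom R M N =
     {f \<in> carrier M \<rightarrow> carrier N.
        (\<forall>x\<in>carrier M. \<forall>y\<in>carrier M. f (x \<oplus>\<^bsub>M\<^esub> y) = f x \<oplus>\<^bsub>N\<^esub> f y) \<and>
        (\<forall>a\<in>carrier R. \<forall>x\<in>carrier M. f (a \<odot>\<^bsub>M\<^esub> x) = a \<odot>\<^bsub>N\<^esub> f x)}"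

text \<open>\<open>M / N\<close>, on the cosets of \<open>N\<close>: \<open>a \<odot> (N + x) = N + a \<odot> x\<close>.\<close>

definition quotient_module :: "('a, 'm) module \<Rightarrow> 'm set \<Rightarrow> ('a, 'm set) module" where
  "quotient_module M N =
     \<lparr>carrier = a_rcosets\<^bsub>M\<^esub> N, mult = undefined, one = undefined,
      zero = N, add = set_add M, smult = (\<lambda>a X. \<Union>x\<in>X. N +>\<^bsub>M\<^esub> (a \<odot>\<^bsub>M\<^esub> x))\<rparr>"

text \<open>The external direct sum: families of finite support, extensional outside the index set.\<close>

definition direct_sum :: "'i set \<Rightarrow> ('i \<Rightarrow> ('a, 'b) module) \<Rightarrow> ('a, 'i \<Rightarrow> 'b) module" where
  "direct_sum I P =
     \<lparr>carrier = {f \<in> (\<Pi>\<^sub>E i\<in>I. carrier (P i)). finite {i \<in> I. f i \<noteq> \<zero>\<^bsub>P i\<^esub>}},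
      mult = undefined, one = undefined,
      zero = (\<lambda>i\<in>I. \<zero>\<^bsub>P i\<^esub>), add = (\<lambda>f g. \<lambda>i\<in>I. f i \<oplus>\<^bsub>P i\<^esub> g i),
      smult = (\<lambda>a f. \<lambda>i\<in>I. a \<odot>\<^bsub>P i\<^esub> f i)\<rparr>"

definition regular_module :: "('a, 'r) ring_scheme \<Rightarrow> ('a, 'a) module" where
  "regular_module R =
     \<lparr>carrier = carrier R, mult = undefined, one = undefined,
      zero = \<zero>\<^bsub>R\<^esub>, add = add R, smult = mult R\<rparr>"

definition finitely_generated :: "('a, 'r) ring_scheme \<Rightarrow> ('a, 'm) module \<Rightarrow> bool" where
  "finitely_generated R M \<longleftrightarrow>
     (\<exists>X \<subseteq> carrier M. finite X \<and> (\<lambda>N. submodule N R M) hull X = carrier M)"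

definition countably_generated :: "('a, 'r) ring_scheme \<Rightarrow> ('a, 'm) module \<Rightarrow> bool" where
  "countably_generated R M \<longleftrightarrow>
     (\<exists>X \<subseteq> carrier M. countable X \<and> (\<lambda>N. submodule N R M) hull X = carrier M)"


section \<open>Noetherian rings\<close>

text \<open>The library locale \<open>noetherian_ring\<close> is about two-sided ideals, hence not the right notion
  for noncommutative rings. Left ideals are the submodules of the regular left module; right ideals
  are the left ideals of the opposite ring. As usual, ``Noetherian'' without qualification means
  left and right Noetherian.\<close>

definition opposite_ring :: "('a, 'r) ring_scheme \<Rightarrow> ('a, 'r) ring_scheme" where
  "opposite_ring R = R\<lparr>mult := (\<lambda>x y. y \<otimes>\<^bsub>R\<^esub> x)\<rparr>"

definition left_noetherian :: "('a, 'r) ring_scheme \<Rightarrow> bool" where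
  "left_noetherian R \<longleftrightarrow>
     (\<forall>I. submodule I R (regular_module R) \<longrightarrow>
        finitely_generated R ((regular_module R)\<lparr>carrier := I\<rparr>))"

definition left_right_noetherian_ring :: "('a, 'r) ring_scheme \<Rightarrow> bool" where
  "left_right_noetherian_ring R \<longleftrightarrow>
     ring R \<and> left_noetherian R \<and> left_noetherian (opposite_ring R)"


section \<open>Projective modules and projective dimension\<close>

text \<open>Projectivity is the lifting property against surjections \<open>g : A \<rightarrow> B\<close>. A definition in HOL
  can only quantify over modules \<open>A\<close>, \<open>B\<close> with carriers in fixed types; the ones chosen here
  accommodate the canonical surjection from the free module on the carrier of \<open>P\<close> onto \<open>P\<close>. By the
  lemma \<open>projective_module_lift\<close> below the lifting property then holds for modules \<open>A\<close>, \<open>B\<close> with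
  carriers in arbitrary types.\<close>

definition projective_module :: "('a, 'r) ring_scheme \<Rightarrow> ('a, 'p) module \<Rightarrow> bool" where
  "projective_module R P \<longleftrightarrow>
     left_module R P \<and>
     (\<forall>(A :: ('a, 'p \<Rightarrow> 'a) module) (B :: ('a, 'p) module) g f.
        left_module R A \<and> left_module R B \<and>
        g \<in> left_module_hom R A B \<and> g ` carrier A = carrier B \<and> f \<in> left_module_hom R P B \<longrightarrow>
        (\<exists>h \<in> left_module_hom R P A. \<forall>x\<in>carrier P. g (h x) = f x))"

text \<open>\<open>resolution R n P d e M\<close>: the sequence
  \<open>0 \<rightarrow> P n \<rightarrow> \<dots> \<rightarrow> P 1 \<rightarrow> P 0 \<rightarrow> M \<rightarrow> 0\<close>, with maps \<open>d k : P (k + 1) \<rightarrow> P k\<close> for \<open>k < n\<close> and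
  \<open>e : P 0 \<rightarrow> M\<close>, is exact. The last conjunct is exactness at \<open>P k\<close>: the incoming image (zero for
  \<open>k = n\<close>) is the kernel of the outgoing map (\<open>e\<close> for \<open>k = 0\<close>).\<close>

definition resolution ::
    "('a, 'r) ring_scheme \<Rightarrow> nat \<Rightarrow> (nat \<Rightarrow> ('a, 'p) module) \<Rightarrow> (nat \<Rightarrow> 'p \<Rightarrow> 'p) \<Rightarrow> ('p \<Rightarrow> 'm) \<Rightarrow>
     ('a, 'm) module \<Rightarrow> bool" where
  "resolution R n P d e M \<longleftrightarrow>
     left_module R M \<and> (\<forall>k\<le>n. left_module R (P k)) \<and>
     e \<in> left_module_hom R (P 0) M \<and> e ` carrier (P 0) = carrier M \<and>
     (\<forall>k<n. d k \<in> left_module_hom R (P (Suc k)) (P k)) \<and>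
     (\<forall>k\<le>n. (if k < n then d k ` carrier (P (Suc k)) else {\<zero>\<^bsub>P k\<^esub>}) =
        (case k of 0 \<Rightarrow> a_kernel (P 0) M e | Suc j \<Rightarrow> a_kernel (P k) (P j) (d j)))"

text \<open>\<open>proj_dim_le TYPE('p) R n M\<close>: there is a projective resolution of \<open>M\<close> of length \<open>n\<close> by modules
  with carriers in the type \<open>'p\<close>. If \<open>'p\<close> is large enough compared with \<open>'a\<close> and \<open>'m\<close>, this is
  \<open>pd M \<le> n\<close>. As a hypothesis with \<open>'p\<close> a type variable of its own, it covers projective
  resolutions of any size.\<close>

definition proj_dim_le ::
    "'p itself \<Rightarrow> ('a, 'r) ring_scheme \<Rightarrow> nat \<Rightarrow> ('a, 'm) module \<Rightarrow> bool" where
  "proj_dim_le T R n M \<longleftrightarrow>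
     (\<exists>(P :: nat \<Rightarrow> ('a, 'p) module) d e.
        (\<forall>k\<le>n. projective_module R (P k)) \<and> resolution R n P d e M)"


section \<open>The class $\mathcal P_n^{\aleph_0}$ and its filtrations\<close>

text \<open>The countable index sets \<open>I k\<close> are taken to be sets of natural numbers. Every countably
  generated projective module is a direct summand of the free module on \<open>\<nat>\<close>, hence isomorphic to a
  module with carrier in the type \<open>nat \<Rightarrow> 'a\<close>. So neither choice restricts the class.\<close>

definition P_aleph0 :: "('a, 'r) ring_scheme \<Rightarrow> nat \<Rightarrow> ('a, 'm) module \<Rightarrow> bool" where
  "P_aleph0 R n M \<longleftrightarrow>
     (\<exists>(I :: nat \<Rightarrow> nat set) (P :: nat \<Rightarrow> nat \<Rightarrow> ('a, nat \<Rightarrow> 'a) module) d e.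
        (\<forall>k\<le>n. \<forall>i\<in>I k. projective_module R (P k i) \<and> countably_generated R (P k i)) \<and>
        resolution R n (\<lambda>k. direct_sum (I k) (P k)) d e M)"

text \<open>An ordinal is represented by a well-order \<open>r\<close>; its elements are those of \<open>Field r\<close>.\<close>

definition ord_zero :: "'i rel \<Rightarrow> 'i \<Rightarrow> bool" where
  "ord_zero r \<alpha> \<longleftrightarrow> \<alpha> \<in> Field r \<and> underS r \<alpha> = {}"

text \<open>\<open>\<beta> = \<alpha> + 1\<close>.\<close>
definition ord_succ :: "'i rel \<Rightarrow> 'i \<Rightarrow> 'i \<Rightarrow> bool" where
  "ord_succ r \<alpha> \<beta> \<longleftrightarrow> \<alpha> \<in> Field r \<and> \<beta> \<in> Field r \<and> underS r \<beta> = under r \<alpha>"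

definition ord_limit :: "'i rel \<Rightarrow> 'i \<Rightarrow> bool" where
  "ord_limit r \<beta> \<longleftrightarrow> \<beta> \<in> Field r \<and> \<not> ord_zero r \<beta> \<and> (\<nexists>\<alpha>. ord_succ r \<alpha> \<beta>)"

text \<open>In a filtration of a module \<open>M\<close> all maps are injective, so the terms are submodules of \<open>M\<close>,
  the maps are inclusions, and the colimits over (initial segments of) the ordinal are unions (see
  \<open>chain_union_is_colimit\<close> below). The cokernel of \<open>F \<alpha> \<subseteq> F (\<alpha> + 1)\<close> is the quotient module.\<close>

definition P_aleph0_filtration ::
    "('a, 'r) ring_scheme \<Rightarrow> nat \<Rightarrow> ('a, 'm) module \<Rightarrow> 'i rel \<Rightarrow> ('i \<Rightarrow> 'm set) \<Rightarrow> bool" where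
  "P_aleph0_filtration R n M r F \<longleftrightarrow>
     Well_order r \<and> Field r \<noteq> {} \<and>
     (\<forall>\<alpha>\<in>Field r. submodule (F \<alpha>) R M) \<and>
     (\<forall>(\<alpha>, \<beta>)\<in>r. F \<alpha> \<subseteq> F \<beta>) \<and>
     (\<forall>\<beta>. ord_limit r \<beta> \<longrightarrow> F \<beta> = (\<Union>\<alpha>\<in>underS r \<beta>. F \<alpha>)) \<and>
     carrier M = (\<Union>\<alpha>\<in>Field r. F \<alpha>) \<and>
     (\<forall>\<alpha>. ord_zero r \<alpha> \<longrightarrow> P_aleph0 R n (M\<lparr>carrier := F \<alpha>\<rparr>)) \<and>
     (\<forall>\<alpha> \<beta>. ord_succ r \<alpha> \<beta> \<longrightarrow> P_aleph0 R n (quotient_module (M\<lparr>carrier := F \<beta>\<rparr>) (F \<alpha>)))"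

section \<open>Adequacy of the definitions\<close>

lemma left_module_direct_sum:
  assumes R: "ring R" and P: "\<And>i. i \<in> I \<Longrightarrow> left_module R (P i)"
  shows "left_module R (direct_sum I P)"
proof -
  have ag: "abelian_group (P i)" if "i \<in> I" for i
    using P[OF that] left_module.axioms(2) by blast
  note am = abelian_group.axioms(1)[OF ag]
  note am_simps = abelian_monoid.a_closed[OF am] abelian_monoid.zero_closed[OF am]
    abelian_monoid.l_zero[OF am] abelian_monoid.r_zero[OF am]
  let ?S = "direct_sum I P"
  have fin2: "finite {i \<in> I. h i \<noteq> \<zero>\<^bsub>P i\<^esub>}"
    if "finite {i \<in> I. f i \<noteq> \<zero>\<^bsub>P i\<^esub>}" "finite {i \<in> I. g i \<noteq> \<zero>\<^bsub>P i\<^esub>}"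
      "\<And>i. i \<in> I \<Longrightarrow> f i = \<zero>\<^bsub>P i\<^esub> \<Longrightarrow> g i = \<zero>\<^bsub>P i\<^esub> \<Longrightarrow> h i = \<zero>\<^bsub>P i\<^esub>" for f g h
    by (rule finite_subset[OF _ finite_UnI[OF that(1,2)]]) (use that(3) in blast)
  have ex: "f = g" if "f \<in> carrier ?S" "g \<in> carrier ?S" "\<And>i. i \<in> I \<Longrightarrow> f i = g i" for f g
    using that by (auto simp: direct_sum_def intro: PiE_ext)
  have mem: "f i \<in> carrier (P i)" if "f \<in> carrier ?S" "i \<in> I" for f i
    using that by (auto simp: direct_sum_def)
  have z: "\<zero>\<^bsub>?S\<^esub> \<in> carrier ?S"
    by (auto simp: direct_sum_def am_simps)
  have zi: "\<zero>\<^bsub>?S\<^esub> i = \<zero>\<^bsub>P i\<^esub>" if "i \<in> I" for i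
    using that by (simp add: direct_sum_def)
  have a: "f \<oplus>\<^bsub>?S\<^esub> g \<in> carrier ?S" if "f \<in> carrier ?S" "g \<in> carrier ?S" for f g
  proof -
    have "finite {i \<in> I. (f \<oplus>\<^bsub>?S\<^esub> g) i \<noteq> \<zero>\<^bsub>P i\<^esub>}"
      by (rule fin2[of f g]) (use that in \<open>auto simp: direct_sum_def am_simps\<close>)
    with that show ?thesis by (auto simp: direct_sum_def intro!: am_simps(1))
  qed
  have ai: "(f \<oplus>\<^bsub>?S\<^esub> g) i = f i \<oplus>\<^bsub>P i\<^esub> g i" if "i \<in> I" for i f g
    using that by (simp add: direct_sum_def)
  have smz: "c \<odot>\<^bsub>P i\<^esub> \<zero>\<^bsub>P i\<^esub> = \<zero>\<^bsub>P i\<^esub>" if "i \<in> I" "c \<in> carrier R" for c i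
  proof -
    interpret left_module R "P i" by (rule P[OF that(1)])
    have "c \<odot>\<^bsub>P i\<^esub> \<zero>\<^bsub>P i\<^esub> \<oplus>\<^bsub>P i\<^esub> c \<odot>\<^bsub>P i\<^esub> \<zero>\<^bsub>P i\<^esub> = c \<odot>\<^bsub>P i\<^esub> \<zero>\<^bsub>P i\<^esub>"
      using smult_r_distr[of c "\<zero>\<^bsub>P i\<^esub>" "\<zero>\<^bsub>P i\<^esub>"] that by simp
    then show ?thesis using that by (simp add: M.add.l_cancel_one)
  qed
  have s: "c \<odot>\<^bsub>?S\<^esub> f \<in> carrier ?S" if "f \<in> carrier ?S" "c \<in> carrier R" for c f
  proof -
    have "finite {i \<in> I. (c \<odot>\<^bsub>?S\<^esub> f) i \<noteq> \<zero>\<^bsub>P i\<^esub>}"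
      by (rule fin2[of f f]) (use that in \<open>auto simp: direct_sum_def smz\<close>)
    with that show ?thesis by (auto simp: direct_sum_def intro!: left_module.smult_closed[OF P])
  qed
  have si: "(c \<odot>\<^bsub>?S\<^esub> f) i = c \<odot>\<^bsub>P i\<^esub> f i" if "i \<in> I" for i c f
    using that by (simp add: direct_sum_def)
  have agS: "abelian_group ?S"
  proof (rule abelian_groupI)
    fix f assume f: "f \<in> carrier ?S"
    define g where "g = (\<lambda>i\<in>I. \<ominus>\<^bsub>P i\<^esub> f i)"
    have nz: "\<ominus>\<^bsub>P i\<^esub> \<zero>\<^bsub>P i\<^esub> = \<zero>\<^bsub>P i\<^esub>" if "i \<in> I" for i
      using that by (intro abelian_group.minus_equality[OF ag]) (simp_all add: am_simps)
    have "finite {i \<in> I. g i \<noteq> \<zero>\<^bsub>P i\<^esub>}"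
      by (rule fin2[of f f]) (use f nz in \<open>auto simp: g_def direct_sum_def\<close>)
    then have "g \<in> carrier ?S"
      using mem[OF f] by (simp add: g_def direct_sum_def abelian_group.a_inv_closed[OF ag])
    moreover have "g \<oplus>\<^bsub>?S\<^esub> f = \<zero>\<^bsub>?S\<^esub>"
      by (rule ex) (use f calculation mem[OF f] in
          \<open>auto simp: a z ai zi g_def abelian_group.l_neg[OF ag]\<close>)
    ultimately show "\<exists>y\<in>carrier ?S. y \<oplus>\<^bsub>?S\<^esub> f = \<zero>\<^bsub>?S\<^esub>" by blast
  next
    fix x y w assume "x \<in> carrier ?S" "y \<in> carrier ?S" "w \<in> carrier ?S"
    then show "x \<oplus>\<^bsub>?S\<^esub> y \<oplus>\<^bsub>?S\<^esub> w = x \<oplus>\<^bsub>?S\<^esub> (y \<oplus>\<^bsub>?S\<^esub> w)"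
      by (intro ex) (simp_all add: a ai mem abelian_monoid.a_assoc[OF am])
  next
    fix x y assume "x \<in> carrier ?S" "y \<in> carrier ?S"
    then show "x \<oplus>\<^bsub>?S\<^esub> y = y \<oplus>\<^bsub>?S\<^esub> x"
      by (intro ex) (simp_all add: a ai mem abelian_monoid.a_comm[OF am])
  next
    fix x assume "x \<in> carrier ?S"
    then show "\<zero>\<^bsub>?S\<^esub> \<oplus>\<^bsub>?S\<^esub> x = x"
      by (intro ex) (simp_all add: a ai zi z mem am_simps)
  qed (simp_all add: a z)
  have add_cl: "b \<oplus>\<^bsub>R\<^esub> c \<in> carrier R" "b \<otimes>\<^bsub>R\<^esub> c \<in> carrier R"
    if "b \<in> carrier R" "c \<in> carrier R" for b c
    using R that by (auto intro: ring.ring_simprules)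
  show ?thesis
    unfolding left_module_def left_module_axioms_def
  proof (intro conjI R agS allI impI)
    fix b c f assume "b \<in> carrier R" "c \<in> carrier R" "f \<in> carrier ?S"
    then show "(b \<oplus>\<^bsub>R\<^esub> c) \<odot>\<^bsub>?S\<^esub> f = b \<odot>\<^bsub>?S\<^esub> f \<oplus>\<^bsub>?S\<^esub> c \<odot>\<^bsub>?S\<^esub> f"
      by (intro ex) (simp_all add: a ai s si mem add_cl left_module.smult_l_distr[OF P])
  next
    fix b f g assume "b \<in> carrier R" "f \<in> carrier ?S" "g \<in> carrier ?S"
    then show "b \<odot>\<^bsub>?S\<^esub> (f \<oplus>\<^bsub>?S\<^esub> g) = b \<odot>\<^bsub>?S\<^esub> f \<oplus>\<^bsub>?S\<^esub> b \<odot>\<^bsub>?S\<^esub> g"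
      by (intro ex) (simp_all add: a ai s si mem left_module.smult_r_distr[OF P])
  next
    fix b c f assume "b \<in> carrier R" "c \<in> carrier R" "f \<in> carrier ?S"
    then show "(b \<otimes>\<^bsub>R\<^esub> c) \<odot>\<^bsub>?S\<^esub> f = b \<odot>\<^bsub>?S\<^esub> (c \<odot>\<^bsub>?S\<^esub> f)"
      by (intro ex) (simp_all add: a ai s si mem add_cl left_module.smult_assoc1[OF P])
  next
    fix f assume "f \<in> carrier ?S"
    then show "\<one>\<^bsub>R\<^esub> \<odot>\<^bsub>?S\<^esub> f = f"
      using R by (intro ex)
        (simp_all add: s si mem left_module.smult_one[OF P] ring.ring_simprules(6))
  qed (simp add: s)
qed

lemma left_module_regular:
  assumes "ring R" shows "left_module R (regular_module R)"
proof -
  interpret ring R by fact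
  have "abelian_group (regular_module R)"
    by (rule abelian_groupI)
      (auto simp: regular_module_def a_assoc intro: a_comm l_neg bexI[of _ "\<ominus>\<^bsub>R\<^esub> x" for x])
  then show ?thesis
    unfolding left_module_def left_module_axioms_def
    by (auto simp: regular_module_def assms l_distr r_distr m_assoc)
qed

context left_module
begin

lemma smult_r_zero: "c \<in> carrier R \<Longrightarrow> c \<odot>\<^bsub>M\<^esub> \<zero>\<^bsub>M\<^esub> = \<zero>\<^bsub>M\<^esub>"
  using smult_r_distr[of c "\<zero>\<^bsub>M\<^esub>" "\<zero>\<^bsub>M\<^esub>"] by (simp add: M.add.l_cancel_one')

lemma smult_l_zero: "x \<in> carrier M \<Longrightarrow> \<zero> \<odot>\<^bsub>M\<^esub> x = \<zero>\<^bsub>M\<^esub>"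
  using smult_l_distr[of \<zero> \<zero> x] by (simp add: M.add.l_cancel_one')

lemma smult_finsum:
  "\<lbrakk>finite A; c \<in> carrier R; f \<in> A \<rightarrow> carrier M\<rbrakk> \<Longrightarrow>
     c \<odot>\<^bsub>M\<^esub> (\<Oplus>\<^bsub>M\<^esub> i \<in> A. f i) = (\<Oplus>\<^bsub>M\<^esub> i \<in> A. c \<odot>\<^bsub>M\<^esub> f i)"
  by (induction A rule: finite_induct) (simp_all add: smult_r_zero Pi_def smult_r_distr)

end

lemma left_module_hom_zero:
  assumes "left_module R M" "left_module R N" "f \<in> left_module_hom R M N"
  shows "f \<zero>\<^bsub>M\<^esub> = \<zero>\<^bsub>N\<^esub>"
proof -
  interpret M: left_module R M by fact
  interpret N: left_module R N by fact
  have *: "f \<zero>\<^bsub>M\<^esub> \<in> carrier N" "f (\<zero>\<^bsub>M\<^esub> \<oplus>\<^bsub>M\<^esub> \<zero>\<^bsub>M\<^esub>) = f \<zero>\<^bsub>M\<^esub> \<oplus>\<^bsub>N\<^esub> f \<zero>\<^bsub>M\<^esub>"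
    using assms(3) unfolding left_module_hom_def by blast+
  then show ?thesis by (simp add: N.M.add.l_cancel_one')
qed

lemma left_module_hom_finsum:
  assumes M: "left_module R M" and N: "left_module R N" and f: "f \<in> left_module_hom R M N"
    and "finite A" "u \<in> A \<rightarrow> carrier M"
  shows "f (\<Oplus>\<^bsub>M\<^esub> i \<in> A. u i) = (\<Oplus>\<^bsub>N\<^esub> i \<in> A. f (u i))"
proof -
  interpret M: left_module R M by fact
  interpret N: left_module R N by fact
  have fc: "f x \<in> carrier N" if "x \<in> carrier M" for x
    using f that by (auto simp: left_module_hom_def)
  show ?thesis using assms(4,5)
  proof (induction A rule: finite_induct)
    case empty
    show ?case using left_module_hom_zero[OF M N f] by simp
  next
    case (insert x A)
    have "f (u x \<oplus>\<^bsub>M\<^esub> (\<Oplus>\<^bsub>M\<^esub> i \<in> A. u i)) = f (u x) \<oplus>\<^bsub>N\<^esub> f (\<Oplus>\<^bsub>M\<^esub> i \<in> A. u i)"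
      using f insert.prems by (auto simp: left_module_hom_def Pi_def)
    then show ?case using insert by (simp add: fc Pi_def)
  qed
qed

text \<open>The homomorphism from the free module on \<open>X\<close> that extends the map \<open>u\<close> on the basis.\<close>

definition free_extend ::
    "('a, 'r) ring_scheme \<Rightarrow> ('a, 'm) module \<Rightarrow> ('x \<Rightarrow> 'm) \<Rightarrow> 'x set \<Rightarrow> ('x \<Rightarrow> 'a) \<Rightarrow> 'm" where
  "free_extend R M u X f = (\<Oplus>\<^bsub>M\<^esub> x \<in> {x \<in> X. f x \<noteq> \<zero>\<^bsub>R\<^esub>}. f x \<odot>\<^bsub>M\<^esub> u x)"

lemma free_extend_hom:
  assumes M: "left_module R M" and u: "u \<in> X \<rightarrow> carrier M"
  shows "free_extend R M u X \<in> left_module_hom R (direct_sum X (\<lambda>_. regular_module R)) M"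
proof -
  interpret left_module R M by fact
  let ?S = "direct_sum X (\<lambda>_. regular_module R)"
  let ?s = "\<lambda>f. {x \<in> X. f x \<noteq> \<zero>\<^bsub>R\<^esub>}"
  have mem: "f x \<in> carrier R" if "f \<in> carrier ?S" "x \<in> X" for f x
    using that by (auto simp: direct_sum_def regular_module_def)
  have fin: "finite (?s f)" if "f \<in> carrier ?S" for f
    using that by (auto simp: direct_sum_def regular_module_def)
  have ux: "u x \<in> carrier M" if "x \<in> X" for x using u that by blast
  have ext: "free_extend R M u X f = (\<Oplus>\<^bsub>M\<^esub> x \<in> B. f x \<odot>\<^bsub>M\<^esub> u x)"
    if "finite B" "?s f \<subseteq> B" "B \<subseteq> X" "\<And>x. x \<in> X \<Longrightarrow> f x \<in> carrier R" for f B
    unfolding free_extend_def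
    by (rule M.add.finprod_mono_neutral_cong_left)
      (use that ux in \<open>auto simp: smult_l_zero\<close>)
  have ai: "(f \<oplus>\<^bsub>?S\<^esub> g) x = f x \<oplus>\<^bsub>R\<^esub> g x" if "x \<in> X" for f g x
    using that by (simp add: direct_sum_def regular_module_def)
  have si: "(c \<odot>\<^bsub>?S\<^esub> f) x = c \<otimes>\<^bsub>R\<^esub> f x" if "x \<in> X" for c f x
    using that by (simp add: direct_sum_def regular_module_def)
  show ?thesis
    unfolding left_module_hom_def
  proof (intro CollectI conjI ballI)
    show "free_extend R M u X \<in> carrier ?S \<rightarrow> carrier M"
      by (auto simp: free_extend_def mem ux intro!: M.finsum_closed)
  next
    fix f g assume f: "f \<in> carrier ?S" and g: "g \<in> carrier ?S"
    let ?B = "?s f \<union> ?s g"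
    have B: "finite ?B" using fin f g by simp
    have "free_extend R M u X (f \<oplus>\<^bsub>?S\<^esub> g) = (\<Oplus>\<^bsub>M\<^esub> x \<in> ?B. (f \<oplus>\<^bsub>?S\<^esub> g) x \<odot>\<^bsub>M\<^esub> u x)"
      by (rule ext[OF B]) (auto simp: ai mem f g)
    also have "\<dots> = (\<Oplus>\<^bsub>M\<^esub> x \<in> ?B. f x \<odot>\<^bsub>M\<^esub> u x \<oplus>\<^bsub>M\<^esub> g x \<odot>\<^bsub>M\<^esub> u x)"
      by (rule M.finsum_cong') (auto simp: ai mem f g ux smult_l_distr)
    also have "\<dots> = (\<Oplus>\<^bsub>M\<^esub> x \<in> ?B. f x \<odot>\<^bsub>M\<^esub> u x) \<oplus>\<^bsub>M\<^esub> (\<Oplus>\<^bsub>M\<^esub> x \<in> ?B. g x \<odot>\<^bsub>M\<^esub> u x)"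
      by (rule M.finsum_addf) (auto simp: mem f g ux)
    also have "(\<Oplus>\<^bsub>M\<^esub> x \<in> ?B. f x \<odot>\<^bsub>M\<^esub> u x) = free_extend R M u X f"
      by (rule ext[OF B, symmetric]) (auto simp: mem f)
    also have "(\<Oplus>\<^bsub>M\<^esub> x \<in> ?B. g x \<odot>\<^bsub>M\<^esub> u x) = free_extend R M u X g"
      by (rule ext[OF B, symmetric]) (auto simp: mem g)
    finally show "free_extend R M u X (f \<oplus>\<^bsub>?S\<^esub> g) =
        free_extend R M u X f \<oplus>\<^bsub>M\<^esub> free_extend R M u X g" .
  next
    fix c f assume c: "c \<in> carrier R" and f: "f \<in> carrier ?S"
    have "free_extend R M u X (c \<odot>\<^bsub>?S\<^esub> f) = (\<Oplus>\<^bsub>M\<^esub> x \<in> ?s f. (c \<odot>\<^bsub>?S\<^esub> f) x \<odot>\<^bsub>M\<^esub> u x)"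
      by (rule ext[OF fin[OF f]]) (auto simp: si mem c f)
    also have "\<dots> = (\<Oplus>\<^bsub>M\<^esub> x \<in> ?s f. c \<odot>\<^bsub>M\<^esub> (f x \<odot>\<^bsub>M\<^esub> u x))"
      by (rule M.finsum_cong') (auto simp: si mem c f ux smult_assoc1)
    also have "\<dots> = c \<odot>\<^bsub>M\<^esub> free_extend R M u X f"
      unfolding free_extend_def
      by (rule smult_finsum[symmetric]) (auto simp: fin c f mem ux)
    finally show "free_extend R M u X (c \<odot>\<^bsub>?S\<^esub> f) = c \<odot>\<^bsub>M\<^esub> free_extend R M u X f" .
  qed
qed

lemma projective_module_lift:
  fixes R :: "('a, 'r) ring_scheme" and P :: "('a, 'p) module"
    and A :: "('a, 'b) module" and B :: "('a, 'c) module"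
  assumes P: "projective_module R P" and A: "left_module R A" and B: "left_module R B"
    and g: "g \<in> left_module_hom R A B" "g ` carrier A = carrier B"
    and f: "f \<in> left_module_hom R P B"
  shows "\<exists>h \<in> left_module_hom R P A. \<forall>x\<in>carrier P. g (h x) = f x"
proof -
  have P': "left_module R P" using P by (simp add: projective_module_def)
  interpret P: left_module R P by fact
  interpret A: left_module R A by fact
  interpret B: left_module R B by fact
  let ?S = "direct_sum (carrier P) (\<lambda>_. regular_module R) :: ('a, 'p \<Rightarrow> 'a) module"
  let ?eps = "free_extend R P (\<lambda>x. x) (carrier P)"
  have S: "left_module R ?S"
    by (intro left_module_direct_sum left_module_regular P.R.ring_axioms)
  have mem: "k x \<in> carrier R" if "k \<in> carrier ?S" "x \<in> carrier P" for k x
    using that by (auto simp: direct_sum_def regular_module_def)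
  have fin: "finite {x \<in> carrier P. k x \<noteq> \<zero>\<^bsub>R\<^esub>}" if "k \<in> carrier ?S" for k
    using that by (auto simp: direct_sum_def regular_module_def)
  have eps: "?eps \<in> left_module_hom R ?S P"
    by (rule free_extend_hom[OF P']) auto
  have surj: "?eps ` carrier ?S = carrier P"
  proof
    show "?eps ` carrier ?S \<subseteq> carrier P" using eps by (auto simp: left_module_hom_def)
    show "carrier P \<subseteq> ?eps ` carrier ?S"
    proof
      fix x assume x: "x \<in> carrier P"
      define k where "k = (\<lambda>y\<in>carrier P. if y = x then \<one>\<^bsub>R\<^esub> else \<zero>\<^bsub>R\<^esub>)"
      have k: "k \<in> carrier ?S"
        by (auto simp: k_def direct_sum_def regular_module_def intro!: finite_subset[of _ "{x}"])
      have one: "x = \<zero>\<^bsub>P\<^esub>" if "\<one>\<^bsub>R\<^esub> = \<zero>\<^bsub>R\<^esub>"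
        using P.smult_one[OF x] P.smult_l_zero[OF x] that by simp
      have "?eps k = (\<Oplus>\<^bsub>P\<^esub> y \<in> {x}. k y \<odot>\<^bsub>P\<^esub> y)"
        unfolding free_extend_def
        by (rule P.M.add.finprod_mono_neutral_cong_left)
          (use x one in \<open>auto simp: k_def P.smult_l_zero split: if_splits\<close>)
      also have "\<dots> = x" using x by (simp add: k_def)
      finally show "x \<in> ?eps ` carrier ?S" using k by (metis imageI)
    qed
  qed
  have idh: "(\<lambda>x. x) \<in> left_module_hom R P P" by (auto simp: left_module_hom_def)
  obtain s where s: "s \<in> left_module_hom R P ?S" "\<And>x. x \<in> carrier P \<Longrightarrow> ?eps (s x) = x"
    using P S P' eps surj idh unfolding projective_module_def by blast
  have "\<forall>x\<in>carrier P. \<exists>a\<in>carrier A. g a = f x"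
  proof
    fix x assume "x \<in> carrier P"
    then have "f x \<in> g ` carrier A" using f g(2) by (auto simp: left_module_hom_def)
    then show "\<exists>a\<in>carrier A. g a = f x" by force
  qed
  then obtain u where u: "\<And>x. x \<in> carrier P \<Longrightarrow> u x \<in> carrier A"
      "\<And>x. x \<in> carrier P \<Longrightarrow> g (u x) = f x"
    by metis
  let ?phi = "free_extend R A u (carrier P)"
  have phi: "?phi \<in> left_module_hom R ?S A"
    by (rule free_extend_hom[OF A]) (use u in auto)
  have gphi: "g (?phi k) = f (?eps k)" if k: "k \<in> carrier ?S" for k
  proof -
    let ?s = "{x \<in> carrier P. k x \<noteq> \<zero>\<^bsub>R\<^esub>}"
    have gc: "g a \<in> carrier B" if "a \<in> carrier A" for a
      using g(1) that by (auto simp: left_module_hom_def)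
    have "g (?phi k) = (\<Oplus>\<^bsub>B\<^esub> x \<in> ?s. g (k x \<odot>\<^bsub>A\<^esub> u x))"
      unfolding free_extend_def
      by (rule left_module_hom_finsum[OF A B g(1) fin[OF k]]) (auto simp: mem[OF k] u)
    also have "\<dots> = (\<Oplus>\<^bsub>B\<^esub> x \<in> ?s. f (k x \<odot>\<^bsub>P\<^esub> x))"
    proof (rule B.M.finsum_cong')
      show "(\<lambda>x. f (k x \<odot>\<^bsub>P\<^esub> x)) \<in> ?s \<rightarrow> carrier B"
        using f by (auto simp: left_module_hom_def mem[OF k] Pi_def)
    next
      fix x assume "x \<in> ?s"
      then show "g (k x \<odot>\<^bsub>A\<^esub> u x) = f (k x \<odot>\<^bsub>P\<^esub> x)"
        using f g(1) u mem[OF k] by (simp add: left_module_hom_def)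
    qed simp
    also have "\<dots> = f (?eps k)"
      unfolding free_extend_def
      by (rule left_module_hom_finsum[OF P' B f fin[OF k], symmetric]) (auto simp: mem[OF k])
    finally show ?thesis .
  qed
  have sc: "s x \<in> carrier ?S" if "x \<in> carrier P" for x
    using s(1) that by (auto simp: left_module_hom_def)
  have "(\<lambda>x. ?phi (s x)) \<in> left_module_hom R P A"
    using s(1) phi by (auto simp: left_module_hom_def Pi_def)
  moreover have "\<forall>x\<in>carrier P. g (?phi (s x)) = f x"
    using gphi sc s(2) by simp
  ultimately show ?thesis
    by (intro bexI[where x = "\<lambda>x. ?phi (s x)"]) blast+
qed

text \<open>The union of a chain of submodules is its colimit: compatible homomorphisms on the members
  of the chain extend uniquely to the union.\<close>

lemma chain_union_is_colimit:
  fixes R :: "('a, 'r) ring_scheme" and M :: "('a, 'm) module" and Y :: "('a, 'y) module"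
    and F :: "'i \<Rightarrow> 'm set"
  assumes sub: "\<And>\<alpha>. \<alpha> \<in> J \<Longrightarrow> submodule (F \<alpha>) R M"
    and chain: "\<And>\<alpha> \<beta>. \<lbrakk>\<alpha> \<in> J; \<beta> \<in> J\<rbrakk> \<Longrightarrow> F \<alpha> \<subseteq> F \<beta> \<or> F \<beta> \<subseteq> F \<alpha>"
    and c: "\<And>\<alpha>. \<alpha> \<in> J \<Longrightarrow> c \<alpha> \<in> left_module_hom R (M\<lparr>carrier := F \<alpha>\<rparr>) Y"
    and compat: "\<And>\<alpha> \<beta> x. \<lbrakk>\<alpha> \<in> J; \<beta> \<in> J; F \<alpha> \<subseteq> F \<beta>; x \<in> F \<alpha>\<rbrakk> \<Longrightarrow> c \<beta> x = c \<alpha> x"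
  defines "U \<equiv> M\<lparr>carrier := (\<Union>\<alpha>\<in>J. F \<alpha>)\<rparr>"
  shows "\<exists>h \<in> left_module_hom R U Y. \<forall>\<alpha>\<in>J. \<forall>x\<in>F \<alpha>. h x = c \<alpha> x"
    and "\<lbrakk>h \<in> left_module_hom R U Y; \<forall>\<alpha>\<in>J. \<forall>x\<in>F \<alpha>. h x = c \<alpha> x;
          h' \<in> left_module_hom R U Y; \<forall>\<alpha>\<in>J. \<forall>x\<in>F \<alpha>. h' x = c \<alpha> x; x \<in> carrier U\<rbrakk>
         \<Longrightarrow> h x = h' x"
proof -
  define h where "h x = c (SOME \<alpha>. \<alpha> \<in> J \<and> x \<in> F \<alpha>) x" for x
  have h: "h x = c \<alpha> x" if "\<alpha> \<in> J" "x \<in> F \<alpha>" for \<alpha> x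
  proof -
    let ?b = "SOME \<alpha>. \<alpha> \<in> J \<and> x \<in> F \<alpha>"
    have b: "?b \<in> J \<and> x \<in> F ?b" by (rule someI[of _ \<alpha>]) (use that in simp)
    then show ?thesis
      using chain[OF that(1), of ?b] compat[of \<alpha> ?b x] compat[of ?b \<alpha> x] that
      unfolding h_def by auto
  qed
  have "h \<in> left_module_hom R U Y"
    unfolding left_module_hom_def
  proof (intro CollectI conjI ballI)
    show "h \<in> carrier U \<rightarrow> carrier Y"
      using c h by (fastforce simp: U_def left_module_hom_def)
  next
    fix x y assume "x \<in> carrier U" "y \<in> carrier U"
    then obtain \<alpha> \<beta> where "\<alpha> \<in> J" "\<beta> \<in> J" "x \<in> F \<alpha>" "y \<in> F \<beta>" by (auto simp: U_def)
    then obtain \<gamma> where g: "\<gamma> \<in> J" "x \<in> F \<gamma>" "y \<in> F \<gamma>" using chain by blast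
    then have "x \<oplus>\<^bsub>M\<^esub> y \<in> F \<gamma>"
      using sub[OF g(1)] subgroup.m_closed[of "F \<gamma>" "add_monoid M"]
      by (auto simp: submodule_def)
    then show "h (x \<oplus>\<^bsub>U\<^esub> y) = h x \<oplus>\<^bsub>Y\<^esub> h y"
      using c[OF g(1)] g h by (simp add: U_def left_module_hom_def)
  next
    fix a x assume a: "a \<in> carrier R" and "x \<in> carrier U"
    then obtain \<alpha> where g: "\<alpha> \<in> J" "x \<in> F \<alpha>" by (auto simp: U_def)
    then have "a \<odot>\<^bsub>M\<^esub> x \<in> F \<alpha>" using submodule.smult_closed[OF sub[OF g(1)] a] by simp
    then show "h (a \<odot>\<^bsub>U\<^esub> x) = a \<odot>\<^bsub>Y\<^esub> h x"
      using c[OF g(1)] g h a by (simp add: U_def left_module_hom_def)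
  qed
  with h show "\<exists>h \<in> left_module_hom R U Y. \<forall>\<alpha>\<in>J. \<forall>x\<in>F \<alpha>. h x = c \<alpha> x" by blast
qed (auto simp: U_def)

end

(*
  Let 0 -> P_n -> ... -> P_0 -> M -> 0 be a projective resolution. A dual basis of P_k, indexed by
  all elements of P_k, attaches to every element a finite support, and a submodule of P_k that is
  closed under supports is a direct summand. Call a family of support-closed submodules A_k of P_k
  good if d maps A_(k+1) into A_k and onto the cycles in A_k. Good families are closed under unions
  of chains. Since R is left Noetherian, the cycles in A_k + T, with T countably generated, are
  countably generated modulo the cycles in A_k. Closing up countably often, every good family A and
  every countable subset of P_0 are contained in a good family B whose members B_k are countably
  generated over A_k. Then B_k is the direct sum of A_k and a countably generated projective module
  C_k, and the C_k form a resolution of the quotient of the images of B_0 and A_0 in M. A transfinite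
  recursion along a well-order of M gives the filtration.
*)

theory Submission
  imports Defs
begin

section \<open>Submodules and homomorphisms\<close>

text \<open>Supports replace a decomposition of each projective into countably generated summands:
  being closed under supports survives unions of chains and can be reached by adding countably many
  elements, and it still makes a submodule a direct summand. The obstacle is exactness. A good
  family need not be countably generated, so enlarging it by countably many elements may create
  uncountably many new cycles. Countably many preimages can kill them only if they are countably
  generated modulo the old cycles. For one new element t this holds because the coefficients r for
  which a + r t is a cycle, for some a in the old submodule, form a left ideal, and left ideals are
  finitely generated. Goodness includes exactness in degree 0, where the cycles are the kernel of
  \<open>e\<close>. Hence A resolves the image of \<open>A 0\<close> in M, and for good A inside
  good B the quotient complex B/A resolves the quotient of the images. The first stage is the zero
  module, so M_1 is the result of a single step of the recursion. Every step absorbs the chosen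
  generators of N, so it does not matter which element the well-order puts first.\<close>

lemma left_module_homI:
  assumes "\<And>x. x \<in> carrier M \<Longrightarrow> f x \<in> carrier N"
    and "\<And>x y. \<lbrakk>x \<in> carrier M; y \<in> carrier M\<rbrakk> \<Longrightarrow> f (x \<oplus>\<^bsub>M\<^esub> y) = f x \<oplus>\<^bsub>N\<^esub> f y"
    and "\<And>a x. \<lbrakk>a \<in> carrier R; x \<in> carrier M\<rbrakk> \<Longrightarrow> f (a \<odot>\<^bsub>M\<^esub> x) = a \<odot>\<^bsub>N\<^esub> f x"
  shows "f \<in> left_module_hom R M N"
  using assms by (auto simp: left_module_hom_def)

lemma left_module_homD:
  assumes "f \<in> left_module_hom R M N"
  shows "x \<in> carrier M \<Longrightarrow> f x \<in> carrier N"
    and "\<lbrakk>x \<in> carrier M; y \<in> carrier M\<rbrakk> \<Longrightarrow> f (x \<oplus>\<^bsub>M\<^esub> y) = f x \<oplus>\<^bsub>N\<^esub> f y"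
    and "\<lbrakk>a \<in> carrier R; x \<in> carrier M\<rbrakk> \<Longrightarrow> f (a \<odot>\<^bsub>M\<^esub> x) = a \<odot>\<^bsub>N\<^esub> f x"
  using assms by (auto simp: left_module_hom_def)

lemma left_module_hom_comp:
  assumes "f \<in> left_module_hom R M N" "g \<in> left_module_hom R N Q"
  shows "(\<lambda>x. g (f x)) \<in> left_module_hom R M Q"
  using assms by (auto simp: left_module_hom_def Pi_def)

lemma submoduleD:
  assumes "submodule H R M"
  shows submodule_subset: "x \<in> H \<Longrightarrow> x \<in> carrier M"
    and submodule_zero: "\<zero>\<^bsub>M\<^esub> \<in> H"
    and submodule_add: "\<lbrakk>x \<in> H; y \<in> H\<rbrakk> \<Longrightarrow> x \<oplus>\<^bsub>M\<^esub> y \<in> H"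
    and submodule_smult: "\<lbrakk>a \<in> carrier R; x \<in> H\<rbrakk> \<Longrightarrow> a \<odot>\<^bsub>M\<^esub> x \<in> H"
    and submodule_neg: "x \<in> H \<Longrightarrow> \<ominus>\<^bsub>M\<^esub> x \<in> H"
proof -
  interpret submodule H R M by fact
  show "x \<in> H \<Longrightarrow> x \<in> carrier M" using subset by auto
  show "\<zero>\<^bsub>M\<^esub> \<in> H" using one_closed by simp
  show "\<lbrakk>x \<in> H; y \<in> H\<rbrakk> \<Longrightarrow> x \<oplus>\<^bsub>M\<^esub> y \<in> H" using m_closed by simp
  show "\<lbrakk>a \<in> carrier R; x \<in> H\<rbrakk> \<Longrightarrow> a \<odot>\<^bsub>M\<^esub> x \<in> H" by (rule smult_closed)
  show "x \<in> H \<Longrightarrow> \<ominus>\<^bsub>M\<^esub> x \<in> H" using m_inv_closed by (simp add: a_inv_def)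
qed

lemma submodule_minus:
  "\<lbrakk>submodule H R M; x \<in> H; y \<in> H\<rbrakk> \<Longrightarrow> x \<ominus>\<^bsub>M\<^esub> y \<in> H"
  by (simp add: a_minus_def submoduleD)

context left_module
begin

lemma smult_minus_one:
  assumes "x \<in> carrier M" shows "(\<ominus> \<one>) \<odot>\<^bsub>M\<^esub> x = \<ominus>\<^bsub>M\<^esub> x"
proof (rule M.minus_equality[symmetric])
  have "(\<ominus> \<one>) \<odot>\<^bsub>M\<^esub> x \<oplus>\<^bsub>M\<^esub> x = (\<ominus> \<one> \<oplus> \<one>) \<odot>\<^bsub>M\<^esub> x"
    using assms by (simp add: smult_l_distr)
  then show "(\<ominus> \<one>) \<odot>\<^bsub>M\<^esub> x \<oplus>\<^bsub>M\<^esub> x = \<zero>\<^bsub>M\<^esub>"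
    using assms by (simp add: R.l_neg smult_l_zero)
qed (use assms in auto)

text \<open>Closure under negation comes from closure under scalars, because -x = (-1) x.\<close>

lemma left_submoduleI:
  assumes "H \<subseteq> carrier M" "\<zero>\<^bsub>M\<^esub> \<in> H"
    and "\<And>x y. \<lbrakk>x \<in> H; y \<in> H\<rbrakk> \<Longrightarrow> x \<oplus>\<^bsub>M\<^esub> y \<in> H"
    and "\<And>a x. \<lbrakk>a \<in> carrier R; x \<in> H\<rbrakk> \<Longrightarrow> a \<odot>\<^bsub>M\<^esub> x \<in> H"
  shows "submodule H R M"
proof (intro submodule.intro subgroup.intro submodule_axioms.intro)
  fix x assume x: "x \<in> H"
  then have "(\<ominus> \<one>) \<odot>\<^bsub>M\<^esub> x \<in> H" using assms(4) by simp
  moreover have "x \<in> carrier M" using x assms(1) by blast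
  ultimately have "\<ominus>\<^bsub>M\<^esub> x \<in> H" by (simp add: smult_minus_one)
  then show "inv\<^bsub>add_monoid M\<^esub> x \<in> H" by (simp add: a_inv_def)
qed (use assms in auto)

lemma submodule_carrier: "submodule (carrier M) R M"
  by (rule left_submoduleI) auto

lemma submodule_zero_set: "submodule {\<zero>\<^bsub>M\<^esub>} R M"
  by (rule left_submoduleI) (auto simp: smult_r_zero)

lemma submodule_Union_chain:
  assumes "\<H> \<noteq> {}" "\<And>H. H \<in> \<H> \<Longrightarrow> submodule H R M"
    and "\<And>H K. \<lbrakk>H \<in> \<H>; K \<in> \<H>\<rbrakk> \<Longrightarrow> H \<subseteq> K \<or> K \<subseteq> H"
  shows "submodule (\<Union>\<H>) R M"
proof (rule left_submoduleI)
  show "\<Union>\<H> \<subseteq> carrier M"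
    by (rule Union_least) (use submodule_subset[OF assms(2)] in blast)
  show "\<zero>\<^bsub>M\<^esub> \<in> \<Union>\<H>" using assms(1) submodule_zero[OF assms(2)] by fast
  show "a \<odot>\<^bsub>M\<^esub> x \<in> \<Union>\<H>" if a: "a \<in> carrier R" and x: "x \<in> \<Union>\<H>" for a x
  proof -
    obtain H where "H \<in> \<H>" "x \<in> H" using x by blast
    then show ?thesis using submodule_smult[OF assms(2) a] by blast
  qed
  fix x y assume "x \<in> \<Union>\<H>" "y \<in> \<Union>\<H>"
  then obtain H where "H \<in> \<H>" "x \<in> H" "y \<in> H" using assms(3) by blast
  then show "x \<oplus>\<^bsub>M\<^esub> y \<in> \<Union>\<H>" using submodule_add[OF assms(2)] by blast
qed

lemma submodule_hull:
  assumes "T \<subseteq> carrier M"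
  shows "submodule ((\<lambda>N. submodule N R M) hull T) R M"
proof (rule left_submoduleI)
  show "(\<lambda>N. submodule N R M) hull T \<subseteq> carrier M"
    using assms submodule_carrier by (rule hull_minimal)
qed (auto simp: hull_def submoduleD)

lemma left_module_submodule:
  assumes H: "submodule H R M" shows "left_module R (M\<lparr>carrier := H\<rparr>)"
proof -
  have c: "x \<in> carrier M" if "x \<in> H" for x using submodule_subset[OF H that] .
  have "abelian_group (M\<lparr>carrier := H\<rparr>)"
  proof (rule abelian_groupI)
    fix x assume "x \<in> carrier (M\<lparr>carrier := H\<rparr>)"
    then show "\<exists>y\<in>carrier (M\<lparr>carrier := H\<rparr>). y \<oplus>\<^bsub>M\<lparr>carrier := H\<rparr>\<^esub> x = \<zero>\<^bsub>M\<lparr>carrier := H\<rparr>\<^esub>"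
      by (intro bexI[of _ "\<ominus>\<^bsub>M\<^esub> x"]) (auto simp: submodule_neg[OF H] M.l_neg c)
  qed (simp_all add: submodule_zero[OF H] submodule_add[OF H] M.a_ac c)
  then show ?thesis
    unfolding left_module_def left_module_axioms_def
    by (auto simp: R.ring_axioms submodule_smult[OF H] smult_l_distr smult_r_distr smult_assoc1 c)
qed

lemma submodule_of_submodule:
  assumes "submodule H R M"
  shows "submodule K R (M\<lparr>carrier := H\<rparr>) \<longleftrightarrow> submodule K R M \<and> K \<subseteq> H"
proof
  assume K: "submodule K R (M\<lparr>carrier := H\<rparr>)"
  have "K \<subseteq> H" using submodule_subset[OF K] by auto
  moreover have "submodule K R M"
    by (rule left_submoduleI)
      (use \<open>K \<subseteq> H\<close> submodule_subset[OF assms] submoduleD[OF K] in auto)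
  ultimately show "submodule K R M \<and> K \<subseteq> H" by blast
next
  assume K: "submodule K R M \<and> K \<subseteq> H"
  interpret H: left_module R "M\<lparr>carrier := H\<rparr>" by (rule left_module_submodule[OF assms])
  show "submodule K R (M\<lparr>carrier := H\<rparr>)"
    by (rule H.left_submoduleI) (use K in \<open>auto simp: submoduleD\<close>)
qed

lemma submodule_finsum:
  assumes "submodule H R M" "finite A" "\<And>i. i \<in> A \<Longrightarrow> f i \<in> H"
  shows "(\<Oplus>\<^bsub>M\<^esub> i \<in> A. f i) \<in> H"
  using assms(2,3)
proof (induction A rule: finite_induct)
  case (insert x A)
  have "f \<in> A \<rightarrow> carrier M" "f x \<in> carrier M" using insert.prems submodule_subset[OF assms(1)] by auto
  then show ?case using insert by (simp add: submodule_add[OF assms(1)])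
qed (simp add: submodule_zero[OF assms(1)])

end

lemma submodule_image:
  assumes M: "left_module R M" and N: "left_module R N" and f: "f \<in> left_module_hom R M N"
    and H: "submodule H R M"
  shows "submodule (f ` H) R N"
proof -
  interpret N: left_module R N by fact
  note c = submodule_subset[OF H]
  show ?thesis
  proof (rule N.left_submoduleI)
    show "f ` H \<subseteq> carrier N" using c left_module_homD(1)[OF f] by blast
    show "\<zero>\<^bsub>N\<^esub> \<in> f ` H" using left_module_hom_zero[OF M N f] submodule_zero[OF H] by (metis imageI)
    show "x \<oplus>\<^bsub>N\<^esub> y \<in> f ` H" if xy: "x \<in> f ` H" "y \<in> f ` H" for x y
    proof -
      obtain x' y' where "x' \<in> H" "x = f x'" "y' \<in> H" "y = f y'" using xy by blast
      then show ?thesis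
        using left_module_homD(2)[OF f c c, of x' y'] submodule_add[OF H, of x' y'] by (metis imageI)
    qed
    show "a \<odot>\<^bsub>N\<^esub> x \<in> f ` H" if a: "a \<in> carrier R" and x: "x \<in> f ` H" for a x
    proof -
      obtain x' where "x' \<in> H" "x = f x'" using x by blast
      then show ?thesis
        using left_module_homD(3)[OF f a c, of x'] submodule_smult[OF H a, of x'] by (metis imageI)
    qed
  qed
qed

lemma submodule_vimage:
  assumes M: "left_module R M" and N: "left_module R N" and f: "f \<in> left_module_hom R M N"
    and H: "submodule H R N"
  shows "submodule {x \<in> carrier M. f x \<in> H} R M"
proof -
  interpret M: left_module R M by fact
  show ?thesis
    by (rule M.left_submoduleI)
      (auto simp: left_module_homD[OF f] submoduleD[OF H] left_module_hom_zero[OF M N f])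
qed

lemma left_module_hom_neg:
  assumes M: "left_module R M" and N: "left_module R N" and f: "f \<in> left_module_hom R M N"
    and x: "x \<in> carrier M"
  shows "f (\<ominus>\<^bsub>M\<^esub> x) = \<ominus>\<^bsub>N\<^esub> f x"
proof -
  interpret M: left_module R M by fact
  interpret N: left_module R N by fact
  have "f ((\<ominus>\<^bsub>R\<^esub> \<one>\<^bsub>R\<^esub>) \<odot>\<^bsub>M\<^esub> x) = (\<ominus>\<^bsub>R\<^esub> \<one>\<^bsub>R\<^esub>) \<odot>\<^bsub>N\<^esub> f x"
    using x by (simp add: left_module_homD[OF f])
  then show ?thesis
    using x by (simp add: M.smult_minus_one N.smult_minus_one left_module_homD[OF f])
qed

lemma left_module_hom_minus:
  assumes M: "left_module R M" and N: "left_module R N" and f: "f \<in> left_module_hom R M N"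
    and x: "x \<in> carrier M" "y \<in> carrier M"
  shows "f (x \<ominus>\<^bsub>M\<^esub> y) = f x \<ominus>\<^bsub>N\<^esub> f y"
proof -
  interpret M: left_module R M by fact
  show ?thesis
    using x by (simp add: a_minus_def left_module_homD[OF f] left_module_hom_neg[OF M N f])
qed

text \<open>Every element of \<open>N\<close> has a preimage, so each axiom is computed in
  \<open>M\<close> and pushed forward. Nothing about \<open>N\<close> is presupposed, which is what
  allows quotient modules to be recognised without calculating with cosets.\<close>

lemma left_module_surjective_image:
  assumes M: "left_module R M" and surj: "f ` carrier M = carrier N"
    and zero: "\<zero>\<^bsub>N\<^esub> = f \<zero>\<^bsub>M\<^esub>" 
    and add: "\<And>x y. \<lbrakk>x \<in> carrier M; y \<in> carrier M\<rbrakk> \<Longrightarrow> f x \<oplus>\<^bsub>N\<^esub> f y = f (x \<oplus>\<^bsub>M\<^esub> y)"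
    and smult: "\<And>a x. \<lbrakk>a \<in> carrier R; x \<in> carrier M\<rbrakk> \<Longrightarrow> a \<odot>\<^bsub>N\<^esub> f x = f (a \<odot>\<^bsub>M\<^esub> x)"
  shows "left_module R N"
proof -
  interpret M: left_module R M by fact
  have ex: "\<exists>x'\<in>carrier M. x = f x'" if "x \<in> carrier N" for x using that surj by blast
  have cl: "f x \<in> carrier N" if "x \<in> carrier M" for x using that surj by blast
  have "abelian_group N"
  proof (rule abelian_groupI)
    fix x assume "x \<in> carrier N"
    then obtain x' where "x' \<in> carrier M" "x = f x'" using ex by blast
    then show "\<exists>y\<in>carrier N. y \<oplus>\<^bsub>N\<^esub> x = \<zero>\<^bsub>N\<^esub>"
      by (intro bexI[of _ "f (\<ominus>\<^bsub>M\<^esub> x')"]) (auto simp: cl add zero M.M.l_neg)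
  next
    fix x y assume "x \<in> carrier N" "y \<in> carrier N"
    then obtain x' y' where "x' \<in> carrier M" "x = f x'" "y' \<in> carrier M" "y = f y'"
      using ex by metis
    then show "x \<oplus>\<^bsub>N\<^esub> y \<in> carrier N" "x \<oplus>\<^bsub>N\<^esub> y = y \<oplus>\<^bsub>N\<^esub> x"
      by (simp_all add: add cl M.M.a_comm)
  next
    fix x y z assume "x \<in> carrier N" "y \<in> carrier N" "z \<in> carrier N"
    then obtain x' y' z' where "x' \<in> carrier M" "x = f x'" "y' \<in> carrier M" "y = f y'"
        "z' \<in> carrier M" "z = f z'"
      using ex by metis
    then show "x \<oplus>\<^bsub>N\<^esub> y \<oplus>\<^bsub>N\<^esub> z = x \<oplus>\<^bsub>N\<^esub> (y \<oplus>\<^bsub>N\<^esub> z)"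
      by (simp add: add M.M.a_assoc)
  next
    fix x assume "x \<in> carrier N"
    then obtain x' where "x' \<in> carrier M" "x = f x'" using ex by blast
    then show "\<zero>\<^bsub>N\<^esub> \<oplus>\<^bsub>N\<^esub> x = x" by (simp add: zero add)
  qed (simp add: cl zero)
  moreover have "a \<odot>\<^bsub>N\<^esub> x \<in> carrier N \<and> (a \<oplus>\<^bsub>R\<^esub> b) \<odot>\<^bsub>N\<^esub> x = a \<odot>\<^bsub>N\<^esub> x \<oplus>\<^bsub>N\<^esub> b \<odot>\<^bsub>N\<^esub> x \<and>
      (a \<otimes>\<^bsub>R\<^esub> b) \<odot>\<^bsub>N\<^esub> x = a \<odot>\<^bsub>N\<^esub> (b \<odot>\<^bsub>N\<^esub> x) \<and> \<one>\<^bsub>R\<^esub> \<odot>\<^bsub>N\<^esub> x = x \<and>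
      a \<odot>\<^bsub>N\<^esub> (x \<oplus>\<^bsub>N\<^esub> y) = a \<odot>\<^bsub>N\<^esub> x \<oplus>\<^bsub>N\<^esub> a \<odot>\<^bsub>N\<^esub> y"
    if ab: "a \<in> carrier R" "b \<in> carrier R" and "x \<in> carrier N" "y \<in> carrier N" for a b x y
  proof -
    obtain x' y' where "x' \<in> carrier M" "x = f x'" "y' \<in> carrier M" "y = f y'"
      using ex \<open>x \<in> carrier N\<close> \<open>y \<in> carrier N\<close> by metis
    then show ?thesis
      using ab by (simp add: add smult cl M.smult_l_distr M.smult_r_distr M.smult_assoc1)
  qed
  ultimately show ?thesis
    unfolding left_module_def left_module_axioms_def using M.R.ring_axioms by blast
qed

text \<open>Generation is intrinsic: the submodules of \<open>H\<close> are the submodules of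
  \<open>M\<close> inside \<open>H\<close>. This links \<open>countably_generated\<close>, which
  takes hulls inside the module in question, with hulls taken in the ambient module.\<close>

lemma (in left_module) hull_submodule_eq:
  assumes H: "submodule H R M" and X: "X \<subseteq> H"
  shows "(\<lambda>N. submodule N R (M\<lparr>carrier := H\<rparr>)) hull X = (\<lambda>N. submodule N R M) hull X"
proof
  have "(\<lambda>N. submodule N R M) hull X \<subseteq> H" using X H by (rule hull_minimal)
  moreover have "submodule ((\<lambda>N. submodule N R M) hull X) R M"
    by (rule submodule_hull) (use X submodule_subset[OF H] in blast)
  ultimately show "(\<lambda>N. submodule N R (M\<lparr>carrier := H\<rparr>)) hull X \<subseteq> (\<lambda>N. submodule N R M) hull X"
    by (intro hull_minimal hull_subset) (simp add: submodule_of_submodule[OF H])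
  show "(\<lambda>N. submodule N R M) hull X \<subseteq> (\<lambda>N. submodule N R (M\<lparr>carrier := H\<rparr>)) hull X"
    by (rule hull_antimono) (simp add: submodule_of_submodule[OF H])
qed

text \<open>One inclusion holds because the image of the hull is a submodule containing the image of
  \<open>T\<close>, the other because the preimage of the right hull is a submodule containing
  \<open>T\<close>.\<close>

lemma hull_image:
  assumes M: "left_module R M" and N: "left_module R N" and f: "f \<in> left_module_hom R M N"
    and T: "T \<subseteq> carrier M"
  shows "(\<lambda>H. submodule H R N) hull (f ` T) = f ` ((\<lambda>H. submodule H R M) hull T)"
proof
  interpret M: left_module R M by fact
  interpret N: left_module R N by fact
  show "(\<lambda>H. submodule H R N) hull (f ` T) \<subseteq> f ` ((\<lambda>H. submodule H R M) hull T)"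
    by (rule hull_minimal) (auto intro: hull_inc submodule_image[OF M N f] M.submodule_hull[OF T])
  have "f ` T \<subseteq> carrier N" using T left_module_homD(1)[OF f] by blast
  then have "submodule {x \<in> carrier M. f x \<in> (\<lambda>H. submodule H R N) hull (f ` T)} R M"
    by (intro submodule_vimage[OF M N f] N.submodule_hull)
  moreover have "T \<subseteq> {x \<in> carrier M. f x \<in> (\<lambda>H. submodule H R N) hull (f ` T)}"
    using T by (auto intro: hull_inc)
  ultimately have "(\<lambda>H. submodule H R M) hull T \<subseteq>
      {x \<in> carrier M. f x \<in> (\<lambda>H. submodule H R N) hull (f ` T)}"
    by (simp add: hull_minimal)
  then show "f ` ((\<lambda>H. submodule H R M) hull T) \<subseteq> (\<lambda>H. submodule H R N) hull (f ` T)" by blast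
qed

lemma countably_generated_image:
  assumes M: "left_module R M" and N: "left_module R N" and f: "f \<in> left_module_hom R M N"
    and surj: "f ` carrier M = carrier N" and cg: "countably_generated R M"
  shows "countably_generated R N"
proof -
  obtain X where X: "X \<subseteq> carrier M" "countable X" "(\<lambda>H. submodule H R M) hull X = carrier M"
    using cg by (auto simp: countably_generated_def)
  show ?thesis
    unfolding countably_generated_def
  proof (intro exI conjI)
    show "f ` X \<subseteq> carrier N" using X(1) surj by blast
    show "countable (f ` X)" using X(2) by simp
    show "(\<lambda>H. submodule H R N) hull (f ` X) = carrier N"
      using hull_image[OF M N f X(1)] X(3) surj by simp
  qed
qed

section \<open>Projective modules\<close>

lemma free_extend_surj:
  assumes M: "left_module R M" and u: "u \<in> X \<rightarrow> carrier M"
    and gen: "(\<lambda>H. submodule H R M) hull (u ` X) = carrier M"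
  shows "free_extend R M u X ` carrier (direct_sum X (\<lambda>_. regular_module R)) = carrier M"
    (is "?g ` carrier ?S = _")
proof
  interpret left_module R M by fact
  have g: "?g \<in> left_module_hom R ?S M" by (rule free_extend_hom[OF M u])
  then show "?g ` carrier ?S \<subseteq> carrier M" by (auto simp: left_module_homD)
  have S: "left_module R ?S"
    by (intro left_module_direct_sum left_module_regular R.ring_axioms)
  have "u x \<in> ?g ` carrier ?S" if x: "x \<in> X" for x
  proof -
    define k where "k = (\<lambda>y\<in>X. if y = x then \<one>\<^bsub>R\<^esub> else \<zero>\<^bsub>R\<^esub>)"
    have k: "k \<in> carrier ?S"
      by (auto simp: k_def direct_sum_def regular_module_def intro!: finite_subset[of _ "{x}"])
    have ux: "u x \<in> carrier M" using u x by blast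
    \<comment> \<open>Over the zero ring the basis vector \<open>k\<close> has empty support; then
      \<open>u x\<close> is zero as well and the one-term sum below is still correct.\<close>
    have one: "u x = \<zero>\<^bsub>M\<^esub>" if "\<one>\<^bsub>R\<^esub> = \<zero>\<^bsub>R\<^esub>"
      using smult_one[OF ux] smult_l_zero[OF ux] that by simp
    have "?g k = (\<Oplus>\<^bsub>M\<^esub> y \<in> {x}. k y \<odot>\<^bsub>M\<^esub> u y)"
      unfolding free_extend_def
      by (rule M.add.finprod_mono_neutral_cong_left)
        (use x ux one in \<open>auto simp: k_def smult_l_zero split: if_splits\<close>)
    also have "\<dots> = u x" using x ux by (simp add: k_def)
    finally show ?thesis using k by (metis imageI)
  qed
  then have "(\<lambda>H. submodule H R M) hull (u ` X) \<subseteq> ?g ` carrier ?S"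
    by (intro hull_minimal submodule_image[OF S M g] left_module.submodule_carrier[OF S]) blast
  with gen show "carrier M \<subseteq> ?g ` carrier ?S" by simp
qed

text \<open>The section is a lift of the identity along the surjection from a free module. Since
  lifting is available in all types, the index set \<open>X\<close> may live in any type.\<close>

lemma projective_section:
  assumes P: "projective_module R P" and u: "u \<in> X \<rightarrow> carrier P"
    and gen: "(\<lambda>H. submodule H R P) hull (u ` X) = carrier P"
  obtains s where "s \<in> left_module_hom R P (direct_sum X (\<lambda>_. regular_module R))"
    and "\<And>x. x \<in> carrier P \<Longrightarrow> free_extend R P u X (s x) = x"
proof -
  have P': "left_module R P" using P by (simp add: projective_module_def)
  then interpret left_module R P .
  have "left_module R (direct_sum X (\<lambda>_. regular_module R))"
    by (intro left_module_direct_sum left_module_regular R.ring_axioms)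
  moreover have "(\<lambda>x. x) \<in> left_module_hom R P P" by (auto simp: left_module_hom_def)
  ultimately show thesis
    using projective_module_lift[OF P _ P' free_extend_hom[OF P' u] free_extend_surj[OF P' u gen]] that
    by blast
qed

text \<open>To lift \<open>h\<close>, lift its composite with \<open>f\<close> and restrict the
  result along \<open>g\<close>. \<open>Q\<close> may have another carrier type than
  \<open>P\<close>, so this also transports projectivity along isomorphisms between types.\<close>

lemma projective_retract:
  fixes P :: "('a, 'p) module" and Q :: "('a, 'q) module"
  assumes P: "projective_module R P" and Q: "left_module R Q"
    and f: "f \<in> left_module_hom R P Q" and g: "g \<in> left_module_hom R Q P"
    and fg: "\<And>y. y \<in> carrier Q \<Longrightarrow> f (g y) = y"
  shows "projective_module R Q"
  unfolding projective_module_def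
proof (intro conjI Q allI impI)
  fix A :: "('a, 'q \<Rightarrow> 'a) module" and B :: "('a, 'q) module" and p h
  assume *: "left_module R A \<and> left_module R B \<and> p \<in> left_module_hom R A B \<and>
    p ` carrier A = carrier B \<and> h \<in> left_module_hom R Q B"
  then have "(\<lambda>x. h (f x)) \<in> left_module_hom R P B" using left_module_hom_comp[OF f] by blast
  then obtain l where l: "l \<in> left_module_hom R P A" "\<And>x. x \<in> carrier P \<Longrightarrow> p (l x) = h (f x)"
    using projective_module_lift[OF P, of A B p "\<lambda>x. h (f x)"] * by blast
  show "\<exists>l\<in>left_module_hom R Q A. \<forall>x\<in>carrier Q. p (l x) = h x"
    using left_module_hom_comp[OF g l(1)] l(2) left_module_homD(1)[OF g] fg
    by (intro bexI[of _ "\<lambda>x. l (g x)"]) auto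
qed

text \<open>For a dual basis \<open>\<phi>\<close> of \<open>P\<close> indexed by all elements of \<open>P\<close>, the support of \<open>p\<close> is
  \<open>{x. \<phi> x p \<noteq> 0}\<close>; on a submodule \<open>A\<close> closed under supports, \<open>p \<mapsto> (\<Sum>x\<in>A. \<phi> x p \<odot> x)\<close> is the
  identity.\<close>

definition support_function ::
    "('a, 'r) ring_scheme \<Rightarrow> ('a, 'p) module \<Rightarrow> ('p \<Rightarrow> 'p set) \<Rightarrow> bool" where
  "support_function R P supp \<longleftrightarrow>
     (\<forall>x\<in>carrier P. finite (supp x) \<and> supp x \<subseteq> carrier P) \<and> supp \<zero>\<^bsub>P\<^esub> = {} \<and>
     (\<forall>x\<in>carrier P. \<forall>y\<in>carrier P. supp (x \<oplus>\<^bsub>P\<^esub> y) \<subseteq> supp x \<union> supp y) \<and>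
     (\<forall>a\<in>carrier R. \<forall>x\<in>carrier P. supp (a \<odot>\<^bsub>P\<^esub> x) \<subseteq> supp x) \<and>
     (\<forall>A. submodule A R P \<longrightarrow> (\<forall>x\<in>A. supp x \<subseteq> A) \<longrightarrow>
        (\<exists>\<rho>\<in>left_module_hom R P (P\<lparr>carrier := A\<rparr>). \<forall>x\<in>A. \<rho> x = x))"

text \<open>The free module on all elements of \<open>P\<close> maps onto \<open>P\<close>; the
  coordinates of a section \<open>s\<close> are the dual basis. The inequalities for supports
  express that these coordinates are additive and homogeneous.\<close>

lemma projective_support:
  fixes P :: "('a, 'p) module"
  assumes P: "projective_module R P"
  shows "\<exists>supp. support_function R P supp"
proof -
  have P': "left_module R P" using P by (simp add: projective_module_def)
  then interpret left_module R P .
  let ?S = "\<lambda>A. direct_sum A (\<lambda>_. regular_module R) :: ('a, 'p \<Rightarrow> 'a) module"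
  have SL: "left_module R (?S A)" for A
    by (intro left_module_direct_sum left_module_regular R.ring_axioms)
  have "(\<lambda>H. submodule H R P) hull ((\<lambda>x. x) ` carrier P) = carrier P"
    using submodule_carrier by (simp add: hull_same)
  then obtain s where s: "s \<in> left_module_hom R P (?S (carrier P))"
      and ss: "\<And>x. x \<in> carrier P \<Longrightarrow> free_extend R P (\<lambda>x. x) (carrier P) (s x) = x"
    using projective_section[OF P, of "\<lambda>x. x" "carrier P"] by auto
  have mem: "s x y \<in> carrier R" if "x \<in> carrier P" "y \<in> carrier P" for x y
    using left_module_homD(1)[OF s that(1)] that(2) by (auto simp: direct_sum_def regular_module_def)
  define supp where "supp x = {y \<in> carrier P. s x y \<noteq> \<zero>\<^bsub>R\<^esub>}" for x
  have fin: "finite (supp x)" if "x \<in> carrier P" for x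
    using left_module_homD(1)[OF s that] by (auto simp: direct_sum_def regular_module_def supp_def)
  have s0: "s \<zero>\<^bsub>P\<^esub> y = \<zero>\<^bsub>R\<^esub>" if "y \<in> carrier P" for y
    using left_module_hom_zero[OF P' SL s] that by (simp add: direct_sum_def regular_module_def)
  have sa: "s (x \<oplus>\<^bsub>P\<^esub> x') y = s x y \<oplus>\<^bsub>R\<^esub> s x' y"
    if "x \<in> carrier P" "x' \<in> carrier P" "y \<in> carrier P" for x x' y
    using left_module_homD(2)[OF s that(1,2)] that(3) by (simp add: direct_sum_def regular_module_def)
  have sm: "s (a \<odot>\<^bsub>P\<^esub> x) y = a \<otimes>\<^bsub>R\<^esub> s x y"
    if "a \<in> carrier R" "x \<in> carrier P" "y \<in> carrier P" for a x y
    using left_module_homD(3)[OF s that(1,2)] that(3) by (simp add: direct_sum_def regular_module_def)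
  have "support_function R P supp"
    unfolding support_function_def
  proof (intro conjI allI impI)
    fix A assume A: "submodule A R P" and "\<forall>x\<in>A. supp x \<subseteq> A"
    then have cl: "supp x \<subseteq> A" if "x \<in> A" for x using that by blast
    note c = submodule_subset[OF A]
    \<comment> \<open>The coordinates outside \<open>A\<close> are discarded. What remains is a
      combination of elements of \<open>A\<close>, hence lies in \<open>A\<close>; for x in
      \<open>A\<close> nothing is lost, because its support lies in \<open>A\<close>.\<close>
    define \<rho> where "\<rho> x = free_extend R P (\<lambda>x. x) A (restrict (s x) A)" for x
    have "(\<lambda>x. restrict (s x) A) \<in> left_module_hom R P (?S A)"
    proof (rule left_module_homI)
      show "restrict (s x) A \<in> carrier (?S A)" if "x \<in> carrier P" for x
        using mem[OF that] c fin[OF that]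
        by (auto simp: direct_sum_def regular_module_def supp_def elim!: rev_finite_subset)
    qed (auto simp: direct_sum_def regular_module_def sa sm c)
    then have "(\<lambda>x. \<rho> x) \<in> left_module_hom R P P"
      unfolding \<rho>_def by (rule left_module_hom_comp) (auto intro!: free_extend_hom P' c)
    moreover have "\<rho> x \<in> A" if "x \<in> carrier P" for x
      unfolding \<rho>_def free_extend_def
      by (rule submodule_finsum[OF A])
        (use fin[OF that] mem[OF that] c in
          \<open>auto simp: supp_def elim!: rev_finite_subset intro!: submodule_smult[OF A]\<close>)
    ultimately have "\<rho> \<in> left_module_hom R P (P\<lparr>carrier := A\<rparr>)"
      by (auto simp: left_module_hom_def)
    moreover have "\<rho> x = x" if x: "x \<in> A" for x
    proof -
      have "\<rho> x = (\<Oplus>\<^bsub>P\<^esub> y \<in> supp x. s x y \<odot>\<^bsub>P\<^esub> y)"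
        unfolding \<rho>_def free_extend_def
        by (rule M.add.finprod_cong') (use cl[OF x] c mem[OF c[OF x]] in \<open>auto simp: supp_def\<close>)
      also have "\<dots> = x" using ss[OF c[OF x]] by (simp add: free_extend_def supp_def)
      finally show ?thesis .
    qed
    ultimately show "\<exists>\<rho>\<in>left_module_hom R P (P\<lparr>carrier := A\<rparr>). \<forall>x\<in>A. \<rho> x = x" by blast
  qed (use fin mem in \<open>auto simp: supp_def s0 sa sm\<close>)
  then show ?thesis by blast
qed

text \<open>A section into the free module on the natural numbers is injective, and its image is the
  required copy of \<open>Q\<close>. This brings modules of any carrier type into the type fixed in
  \<open>P_aleph0\<close>.\<close>

lemma countably_generated_projective_coordinates:
  fixes Q :: "('a, 'q) module"
  assumes Q: "projective_module R Q" and cg: "countably_generated R Q"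
  obtains P :: "('a, nat \<Rightarrow> 'a) module" and \<sigma> \<tau> where
    "projective_module R P" "countably_generated R P"
    "\<sigma> \<in> left_module_hom R Q P" "\<tau> \<in> left_module_hom R P Q"
    "\<And>x. x \<in> carrier Q \<Longrightarrow> \<tau> (\<sigma> x) = x" "\<And>y. y \<in> carrier P \<Longrightarrow> \<sigma> (\<tau> y) = y"
proof -
  have Q': "left_module R Q" using Q by (simp add: projective_module_def)
  then interpret left_module R Q .
  obtain X where X: "X \<subseteq> carrier Q" "countable X" "(\<lambda>H. submodule H R Q) hull X = carrier Q"
    using cg by (auto simp: countably_generated_def)
  \<comment> \<open>Adding zero to the generators makes the set nonempty, as its enumeration
    requires, and does not change the hull.\<close>
  define u where "u = from_nat_into (insert \<zero>\<^bsub>Q\<^esub> X)"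
  have ran: "range u = insert \<zero>\<^bsub>Q\<^esub> X" unfolding u_def using X(2) by (simp add: range_from_nat_into)
  have "range u \<subseteq> carrier Q" using ran X(1) by auto
  then have u: "u \<in> UNIV \<rightarrow> carrier Q" by (simp add: image_subset_iff_funcset)
  have gen: "(\<lambda>H. submodule H R Q) hull (range u) = carrier Q"
  proof
    show "(\<lambda>H. submodule H R Q) hull (range u) \<subseteq> carrier Q"
      by (rule hull_minimal) (use u submodule_carrier in auto)
    show "carrier Q \<subseteq> (\<lambda>H. submodule H R Q) hull (range u)"
      unfolding ran X(3)[symmetric] by (rule hull_mono) blast
  qed
  let ?S = "direct_sum UNIV (\<lambda>_. regular_module R) :: ('a, nat \<Rightarrow> 'a) module"
  have S: "left_module R ?S"
    by (intro left_module_direct_sum left_module_regular R.ring_axioms)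
  obtain s where s: "s \<in> left_module_hom R Q ?S"
      and ss: "\<And>x. x \<in> carrier Q \<Longrightarrow> free_extend R Q u UNIV (s x) = x"
    using projective_section[OF Q u gen] by blast
  have sub: "submodule (s ` carrier Q) R ?S" by (rule submodule_image[OF Q' S s submodule_carrier])
  define P where "P = ?S\<lparr>carrier := s ` carrier Q\<rparr>"
  have P: "left_module R P" unfolding P_def by (rule left_module.left_module_submodule[OF S sub])
  have \<sigma>: "s \<in> left_module_hom R Q P" using s by (auto simp: P_def left_module_hom_def)
  have \<tau>: "free_extend R Q u UNIV \<in> left_module_hom R P Q"
    using free_extend_hom[OF Q' u] submodule_subset[OF sub]
    by (auto simp: P_def left_module_hom_def Pi_iff)
  have inv: "s (free_extend R Q u UNIV y) = y" if "y \<in> carrier P" for y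
    using that ss by (auto simp: P_def)
  show thesis
    by (rule that[OF projective_retract[OF Q P \<sigma> \<tau> inv]
          countably_generated_image[OF Q' P \<sigma> _ cg] \<sigma> \<tau> ss inv]) (auto simp: P_def)
qed

section \<open>Resolutions\<close>

text \<open>A resolution is transported along isomorphisms in each degree by conjugating its
  differentials; \<open>M\<close> itself stays fixed.\<close>

lemma resolution_iso:
  assumes res: "resolution R n P d e M"
    and Q: "\<And>k. k \<le> n \<Longrightarrow> left_module R (Q k)"
    and \<sigma>: "\<And>k. k \<le> n \<Longrightarrow> \<sigma> k \<in> left_module_hom R (P k) (Q k)"
    and \<tau>: "\<And>k. k \<le> n \<Longrightarrow> \<tau> k \<in> left_module_hom R (Q k) (P k)"
    and ts: "\<And>k x. \<lbrakk>k \<le> n; x \<in> carrier (P k)\<rbrakk> \<Longrightarrow> \<tau> k (\<sigma> k x) = x"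
    and st: "\<And>k y. \<lbrakk>k \<le> n; y \<in> carrier (Q k)\<rbrakk> \<Longrightarrow> \<sigma> k (\<tau> k y) = y"
  shows "resolution R n Q (\<lambda>k y. \<sigma> k (d k (\<tau> (Suc k) y))) (\<lambda>y. e (\<tau> 0 y)) M"
proof -
  have M: "left_module R M" and P: "\<And>k. k \<le> n \<Longrightarrow> left_module R (P k)"
    and e: "e \<in> left_module_hom R (P 0) M" "e ` carrier (P 0) = carrier M"
    and d: "\<And>k. k < n \<Longrightarrow> d k \<in> left_module_hom R (P (Suc k)) (P k)"
    and ex: "\<And>k. k \<le> n \<Longrightarrow> (if k < n then d k ` carrier (P (Suc k)) else {\<zero>\<^bsub>P k\<^esub>}) =
        (case k of 0 \<Rightarrow> a_kernel (P 0) M e | Suc j \<Rightarrow> a_kernel (P k) (P j) (d j))"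
    using res unfolding resolution_def by blast+
  have im: "\<tau> k ` carrier (Q k) = carrier (P k)" if "k \<le> n" for k
    using left_module_homD(1)[OF \<tau>[OF that]] left_module_homD(1)[OF \<sigma>[OF that]] ts[OF that] st[OF that]
    by (auto simp: image_iff) metis
  have z: "\<sigma> k \<zero>\<^bsub>P k\<^esub> = \<zero>\<^bsub>Q k\<^esub>" if "k \<le> n" for k
    by (rule left_module_hom_zero[OF P[OF that] Q[OF that] \<sigma>[OF that]])
  \<comment> \<open>Injectivity of \<open>\<sigma> k\<close>: the outer \<open>\<sigma> j\<close> in
    the new differential therefore does not enlarge its kernel.\<close>
  have z0: "\<sigma> k x = \<zero>\<^bsub>Q k\<^esub> \<longleftrightarrow> x = \<zero>\<^bsub>P k\<^esub>" if "k \<le> n" "x \<in> carrier (P k)" for k x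
    using z[OF that(1)] ts[OF that] ts[OF that(1), of "\<zero>\<^bsub>P k\<^esub>"]
      submodule_zero[OF left_module.submodule_carrier[OF P[OF that(1)]]] by metis
  have ker: "{y \<in> carrier (Q k). \<phi> (\<tau> k y)} = \<sigma> k ` {x \<in> carrier (P k). \<phi> x}" if "k \<le> n" for k \<phi>
    using left_module_homD(1)[OF \<tau>[OF that]] left_module_homD(1)[OF \<sigma>[OF that]] ts[OF that] st[OF that]
    by (auto simp: image_iff) metis
  show ?thesis
    unfolding resolution_def
  proof (intro conjI allI impI)
    show "(\<lambda>y. e (\<tau> 0 y)) \<in> left_module_hom R (Q 0) M" by (rule left_module_hom_comp[OF \<tau> e(1)]) simp
    show "(\<lambda>y. e (\<tau> 0 y)) ` carrier (Q 0) = carrier M"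
      using im[of 0] e(2) by (simp add: image_image[symmetric])
    show "(\<lambda>y. \<sigma> k (d k (\<tau> (Suc k) y))) \<in> left_module_hom R (Q (Suc k)) (Q k)" if "k < n" for k
      using that by (intro left_module_hom_comp[OF left_module_hom_comp[OF \<tau> d] \<sigma>]) auto
    fix k assume k: "k \<le> n"
    have "(if k < n then (\<lambda>y. \<sigma> k (d k (\<tau> (Suc k) y))) ` carrier (Q (Suc k)) else {\<zero>\<^bsub>Q k\<^esub>}) =
        \<sigma> k ` (if k < n then d k ` carrier (P (Suc k)) else {\<zero>\<^bsub>P k\<^esub>})"
      using im[of "Suc k", symmetric] z[OF k] by (simp add: image_image)
    also have "\<dots> = \<sigma> k ` (case k of 0 \<Rightarrow> a_kernel (P 0) M e | Suc j \<Rightarrow> a_kernel (P k) (P j) (d j))"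
      using ex[OF k] by simp
    also have "\<dots> = (case k of 0 \<Rightarrow> a_kernel (Q 0) M (\<lambda>y. e (\<tau> 0 y)) |
        Suc j \<Rightarrow> a_kernel (Q k) (Q j) (\<lambda>y. \<sigma> j (d j (\<tau> (Suc j) y))))"
    proof (cases k)
      case 0
      then show ?thesis using ker[of 0 "\<lambda>x. e x = \<zero>\<^bsub>M\<^esub>"] by (simp add: a_kernel_def')
    next
      case (Suc j)
      have "d j (\<tau> k y) \<in> carrier (P j)" if "y \<in> carrier (Q k)" for y
        using left_module_homD(1)[OF d] left_module_homD(1)[OF \<tau>[OF k] that] Suc k by simp
      then have "{y \<in> carrier (Q k). \<sigma> j (d j (\<tau> k y)) = \<zero>\<^bsub>Q j\<^esub>} =
          {y \<in> carrier (Q k). d j (\<tau> k y) = \<zero>\<^bsub>P j\<^esub>}"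
        using z0[of j] Suc k by auto
      then show ?thesis using ker[of k "\<lambda>x. d j x = \<zero>\<^bsub>P j\<^esub>"] k Suc by (simp add: a_kernel_def')
    qed
    finally show "(if k < n then (\<lambda>y. \<sigma> k (d k (\<tau> (Suc k) y))) ` carrier (Q (Suc k)) else {\<zero>\<^bsub>Q k\<^esub>}) =
       (case k of 0 \<Rightarrow> a_kernel (Q 0) M (\<lambda>y. e (\<tau> 0 y)) |
        Suc j \<Rightarrow> a_kernel (Q k) (Q j) (\<lambda>y. \<sigma> j (d j (\<tau> (Suc j) y))))" .
  qed (use M Q in auto)
qed

text \<open>A countably generated projective term counts as a direct sum with the single index 0.
  Two changes of coordinates are needed: into the type \<open>nat \<Rightarrow> 'a\<close>, and from
  a module to the functions on \<open>{0}\<close> with values in it.\<close>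

lemma P_aleph0I:
  fixes P :: "nat \<Rightarrow> ('a, 'p) module"
  assumes res: "resolution R n P d e M"
    and P: "\<And>k. k \<le> n \<Longrightarrow> projective_module R (P k)"
    and cg: "\<And>k. k \<le> n \<Longrightarrow> countably_generated R (P k)"
  shows "P_aleph0 R n M"
proof -
  have "\<forall>k. \<exists>(Q :: ('a, nat \<Rightarrow> 'a) module) \<sigma> \<tau>. k \<le> n \<longrightarrow>
      projective_module R Q \<and> countably_generated R Q \<and>
      \<sigma> \<in> left_module_hom R (P k) Q \<and> \<tau> \<in> left_module_hom R Q (P k) \<and>
      (\<forall>x\<in>carrier (P k). \<tau> (\<sigma> x) = x) \<and> (\<forall>y\<in>carrier Q. \<sigma> (\<tau> y) = y)"
    (is "\<forall>k. ?ex k")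
  proof
    fix k
    show "?ex k"
    proof (cases "k \<le> n")
      case True
      show ?thesis
        by (rule countably_generated_projective_coordinates[OF P[OF True] cg[OF True]]) blast
    qed blast
  qed
  then obtain Q :: "nat \<Rightarrow> ('a, nat \<Rightarrow> 'a) module" and \<sigma> \<tau> where
      Q: "\<And>k. k \<le> n \<Longrightarrow> projective_module R (Q k)" "\<And>k. k \<le> n \<Longrightarrow> countably_generated R (Q k)"
      and \<sigma>: "\<And>k. k \<le> n \<Longrightarrow> \<sigma> k \<in> left_module_hom R (P k) (Q k)"
      and \<tau>: "\<And>k. k \<le> n \<Longrightarrow> \<tau> k \<in> left_module_hom R (Q k) (P k)"
      and ts: "\<And>k x. \<lbrakk>k \<le> n; x \<in> carrier (P k)\<rbrakk> \<Longrightarrow> \<tau> k (\<sigma> k x) = x"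
      and st: "\<And>k y. \<lbrakk>k \<le> n; y \<in> carrier (Q k)\<rbrakk> \<Longrightarrow> \<sigma> k (\<tau> k y) = y"
    unfolding choice_iff by blast
  have QL: "left_module R (Q k)" if "k \<le> n" for k using Q(1)[OF that] by (simp add: projective_module_def)
  let ?D = "\<lambda>k. direct_sum {0 :: nat} (\<lambda>_. Q k)"
  have R: "ring R" using QL[of 0] by (auto simp: left_module_def)
  have D: "left_module R (?D k)" if "k \<le> n" for k
    by (rule left_module_direct_sum[OF R QL[OF that]])
  have ex: "f = restrict (\<lambda>_. f 0) {0}" if "f \<in> carrier (?D k)" for f k
    using that by (auto simp: direct_sum_def fun_eq_iff PiE_def extensional_def)
  have y0: "y 0 \<in> carrier (Q k)" if "y \<in> carrier (?D k)" for y k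
    using that by (auto simp: direct_sum_def)
  have sum_simps: "(f \<oplus>\<^bsub>?D k\<^esub> g) 0 = f 0 \<oplus>\<^bsub>Q k\<^esub> g 0" "(a \<odot>\<^bsub>?D k\<^esub> f) 0 = a \<odot>\<^bsub>Q k\<^esub> f 0" for f g a k
    by (simp_all add: direct_sum_def)
  let ?d = "\<lambda>k y. restrict (\<lambda>_. \<sigma> k (d k (\<tau> (Suc k) (y 0)))) {0}" and ?e = "\<lambda>y. e (\<tau> 0 (y 0))"
  have "resolution R n ?D ?d ?e M"
  proof (rule resolution_iso[OF res D, where \<sigma> = "\<lambda>k x. restrict (\<lambda>_. \<sigma> k x) {0}" and \<tau> = "\<lambda>k y. \<tau> k (y 0)"])
    fix k assume k: "k \<le> n"
    show "(\<lambda>x. \<lambda>_\<in>{0}. \<sigma> k x) \<in> left_module_hom R (P k) (?D k)"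
      using \<sigma>[OF k] by (auto simp: left_module_hom_def direct_sum_def)
    show "(\<lambda>y. \<tau> k (y 0)) \<in> left_module_hom R (?D k) (P k)"
      by (rule left_module_homI)
        (simp_all add: y0 sum_simps left_module_homD[OF \<tau>[OF k]])
    show "\<tau> k ((\<lambda>_\<in>{0}. \<sigma> k x) 0) = x" if "x \<in> carrier (P k)" for x using ts[OF k that] by simp
    show "(\<lambda>_\<in>{0}. \<sigma> k (\<tau> k (y 0))) = y" if y: "y \<in> carrier (?D k)" for y
    proof -
      have "(\<lambda>_\<in>{0}. \<sigma> k (\<tau> k (y 0))) = (\<lambda>_\<in>{0}. y 0)" using st[OF k y0[OF y]] by simp
      also note ex[OF y, symmetric]
      finally show ?thesis .
    qed
  qed auto
  then show ?thesis
    unfolding P_aleph0_def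
    by (intro exI[of _ "\<lambda>_. {0}"] exI[of _ "\<lambda>k _. Q k"] exI[of _ ?d] exI[of _ ?e])
      (simp add: Q)
qed

section \<open>Noetherian rings\<close>

lemma (in abelian_group) add_minus_cancel:
  "\<lbrakk>x \<in> carrier G; y \<in> carrier G\<rbrakk> \<Longrightarrow> x \<oplus> y \<ominus> y = x"
  by (simp add: a_minus_def a_assoc r_neg)

lemma (in abelian_group) minus_self: "x \<in> carrier G \<Longrightarrow> x \<ominus> x = \<zero>"
  by (simp add: a_minus_def r_neg)

section \<open>Intersecting a submodule with an extension by countably many generators\<close>

lemma (in left_module) submodule_sum_cyclic:
  assumes B: "submodule B R M" and t: "t \<in> carrier M"
  shows "submodule {b \<oplus>\<^bsub>M\<^esub> r \<odot>\<^bsub>M\<^esub> t | b r. b \<in> B \<and> r \<in> carrier R} R M" (is "submodule ?S R M")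
proof (rule left_submoduleI)
  note c = submodule_subset[OF B]
  show "?S \<subseteq> carrier M" using t by (auto simp: c)
  have "\<zero>\<^bsub>M\<^esub> = \<zero>\<^bsub>M\<^esub> \<oplus>\<^bsub>M\<^esub> \<zero> \<odot>\<^bsub>M\<^esub> t" using t by (simp add: smult_l_zero)
  then show "\<zero>\<^bsub>M\<^esub> \<in> ?S" using submodule_zero[OF B] R.zero_closed by blast
  fix x y assume "x \<in> ?S" "y \<in> ?S"
  then obtain b r b' r' where *: "b \<in> B" "r \<in> carrier R" "b' \<in> B" "r' \<in> carrier R"
      and xy: "x = b \<oplus>\<^bsub>M\<^esub> r \<odot>\<^bsub>M\<^esub> t" "y = b' \<oplus>\<^bsub>M\<^esub> r' \<odot>\<^bsub>M\<^esub> t" by blast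
  have "x \<oplus>\<^bsub>M\<^esub> y = (b \<oplus>\<^bsub>M\<^esub> b') \<oplus>\<^bsub>M\<^esub> (r \<oplus> r') \<odot>\<^bsub>M\<^esub> t"
    using * t by (simp add: xy c smult_l_distr M.a_ac)
  then show "x \<oplus>\<^bsub>M\<^esub> y \<in> ?S" using * submodule_add[OF B] R.a_closed by blast
next
  note c = submodule_subset[OF B]
  fix a x assume a: "a \<in> carrier R" and "x \<in> ?S"
  then obtain b r where *: "b \<in> B" "r \<in> carrier R" and x: "x = b \<oplus>\<^bsub>M\<^esub> r \<odot>\<^bsub>M\<^esub> t" by blast
  have "a \<odot>\<^bsub>M\<^esub> x = a \<odot>\<^bsub>M\<^esub> b \<oplus>\<^bsub>M\<^esub> (a \<otimes> r) \<odot>\<^bsub>M\<^esub> t"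
    using * t a by (simp add: x c smult_r_distr smult_assoc1)
  then show "a \<odot>\<^bsub>M\<^esub> x \<in> ?S" using * a submodule_smult[OF B] R.m_closed by blast
qed

text \<open>This left ideal consists of the r for which r t lies in A + W.\<close>

lemma (in left_module) submodule_coefficients:
  assumes A: "submodule A R M" and W: "submodule W R M" and t: "t \<in> carrier M"
  shows "submodule {r \<in> carrier R. \<exists>a\<in>A. a \<oplus>\<^bsub>M\<^esub> r \<odot>\<^bsub>M\<^esub> t \<in> W} R (regular_module R)"
    (is "submodule ?I R _")
proof -
  interpret reg: left_module R "regular_module R" by (intro left_module_regular R.ring_axioms)
  note c = submodule_subset[OF A]
  show ?thesis
  proof (rule reg.left_submoduleI)
    show "?I \<subseteq> carrier (regular_module R)" by (auto simp: regular_module_def)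
    have "\<zero>\<^bsub>M\<^esub> \<oplus>\<^bsub>M\<^esub> \<zero> \<odot>\<^bsub>M\<^esub> t \<in> W" using t submodule_zero[OF W] by (simp add: smult_l_zero)
    then show "\<zero>\<^bsub>regular_module R\<^esub> \<in> ?I"
      using submodule_zero[OF A] by (auto simp: regular_module_def)
  next
    fix r r' assume "r \<in> ?I" "r' \<in> ?I"
    then obtain a a' where *: "r \<in> carrier R" "r' \<in> carrier R" "a \<in> A" "a' \<in> A"
        "a \<oplus>\<^bsub>M\<^esub> r \<odot>\<^bsub>M\<^esub> t \<in> W" "a' \<oplus>\<^bsub>M\<^esub> r' \<odot>\<^bsub>M\<^esub> t \<in> W" by blast
    have "(a \<oplus>\<^bsub>M\<^esub> a') \<oplus>\<^bsub>M\<^esub> (r \<oplus> r') \<odot>\<^bsub>M\<^esub> t = (a \<oplus>\<^bsub>M\<^esub> r \<odot>\<^bsub>M\<^esub> t) \<oplus>\<^bsub>M\<^esub> (a' \<oplus>\<^bsub>M\<^esub> r' \<odot>\<^bsub>M\<^esub> t)"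
      using * t by (simp add: c smult_l_distr M.a_ac)
    then have "(a \<oplus>\<^bsub>M\<^esub> a') \<oplus>\<^bsub>M\<^esub> (r \<oplus> r') \<odot>\<^bsub>M\<^esub> t \<in> W" using * submodule_add[OF W] by simp
    then show "r \<oplus>\<^bsub>regular_module R\<^esub> r' \<in> ?I"
      using * submodule_add[OF A] by (auto simp: regular_module_def)
  next
    fix s r assume s: "s \<in> carrier R" and "r \<in> ?I"
    then obtain a where *: "r \<in> carrier R" "a \<in> A" "a \<oplus>\<^bsub>M\<^esub> r \<odot>\<^bsub>M\<^esub> t \<in> W" by blast
    have "s \<odot>\<^bsub>M\<^esub> a \<oplus>\<^bsub>M\<^esub> (s \<otimes> r) \<odot>\<^bsub>M\<^esub> t = s \<odot>\<^bsub>M\<^esub> (a \<oplus>\<^bsub>M\<^esub> r \<odot>\<^bsub>M\<^esub> t)"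
      using * s t by (simp add: c smult_r_distr smult_assoc1)
    then have "s \<odot>\<^bsub>M\<^esub> a \<oplus>\<^bsub>M\<^esub> (s \<otimes> r) \<odot>\<^bsub>M\<^esub> t \<in> W" using * s submodule_smult[OF W] by simp
    then show "s \<odot>\<^bsub>regular_module R\<^esub> r \<in> ?I"
      using * s submodule_smult[OF A] by (auto simp: regular_module_def)
  qed
qed

text \<open>Two elements of \<open>K\<close> of the form a + r t with the same r differ by an
  element of \<open>K\<close> and \<open>A\<close>. So modulo the intersection of \<open>K\<close>
  and \<open>A\<close> such an element depends only on r, and the possible r form a finitely
  generated left ideal. \<open>G\<close> holds one element of \<open>K\<close> for each ideal
  generator.\<close>

lemma (in left_module) noetherian_cyclic_step:
  assumes noeth: "left_noetherian R" and A: "submodule A R M" and K: "submodule K R M"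
    and t: "t \<in> carrier M"
  obtains G where "finite G" "G \<subseteq> K"
    "K \<inter> {a \<oplus>\<^bsub>M\<^esub> r \<odot>\<^bsub>M\<^esub> t | a r. a \<in> A \<and> r \<in> carrier R} \<subseteq>
       (\<lambda>N. submodule N R M) hull (K \<inter> A \<union> G)"
proof -
  interpret reg: left_module R "regular_module R" by (intro left_module_regular R.ring_axioms)
  note cA = submodule_subset[OF A] and cK = submodule_subset[OF K]
  let ?I = "\<lambda>W. {r \<in> carrier R. \<exists>a\<in>A. a \<oplus>\<^bsub>M\<^esub> r \<odot>\<^bsub>M\<^esub> t \<in> W}"
  have I: "submodule (?I W) R (regular_module R)" if "submodule W R M" for W
    by (rule submodule_coefficients[OF A that t])
  obtain X where X: "X \<subseteq> ?I K" "finite X"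
      and gen: "(\<lambda>N. submodule N R (regular_module R\<lparr>carrier := ?I K\<rparr>)) hull X = ?I K"
    using noeth I[OF K] unfolding left_noetherian_def finitely_generated_def by auto
  have "\<forall>r\<in>X. \<exists>a. a \<in> A \<and> a \<oplus>\<^bsub>M\<^esub> r \<odot>\<^bsub>M\<^esub> t \<in> K" using X(1) by blast
  then obtain a where a: "\<And>r. r \<in> X \<Longrightarrow> a r \<in> A \<and> a r \<oplus>\<^bsub>M\<^esub> r \<odot>\<^bsub>M\<^esub> t \<in> K"
    unfolding bchoice_iff by blast
  define G where "G = (\<lambda>r. a r \<oplus>\<^bsub>M\<^esub> r \<odot>\<^bsub>M\<^esub> t) ` X"
  define W where "W = (\<lambda>N. submodule N R M) hull (K \<inter> A \<union> G)"
  have GK: "G \<subseteq> K" using a by (auto simp: G_def)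
  have W: "submodule W R M" unfolding W_def by (rule submodule_hull) (use GK cK in blast)
  have WK: "W \<subseteq> K" unfolding W_def by (rule hull_minimal) (use GK K in auto)
  have sub: "K \<inter> A \<union> G \<subseteq> W" unfolding W_def by (rule hull_subset)
  \<comment> \<open>The coefficients that occur in \<open>W\<close> form a left ideal containing the
    generators \<open>X\<close>, so every coefficient that occurs in \<open>K\<close> already occurs
    in \<open>W\<close>.\<close>
  have "X \<subseteq> ?I W" using X(1) a sub by (force simp: G_def)
  moreover have "submodule (?I W) R (regular_module R\<lparr>carrier := ?I K\<rparr>)"
    unfolding reg.submodule_of_submodule[OF I[OF K]] using I[OF W] WK by blast
  ultimately have "(\<lambda>N. submodule N R (regular_module R\<lparr>carrier := ?I K\<rparr>)) hull X \<subseteq> ?I W"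
    by (rule hull_minimal)
  then have "?I K \<subseteq> ?I W" by (simp only: gen)
  have mem: "b \<oplus>\<^bsub>M\<^esub> r \<odot>\<^bsub>M\<^esub> t \<in> W"
    if x: "b \<oplus>\<^bsub>M\<^esub> r \<odot>\<^bsub>M\<^esub> t \<in> K" and b: "b \<in> A" and r: "r \<in> carrier R" for b r
  proof -
    have "r \<in> ?I W" using x b r \<open>?I K \<subseteq> ?I W\<close> by blast
    then obtain b' where b': "b' \<in> A" "b' \<oplus>\<^bsub>M\<^esub> r \<odot>\<^bsub>M\<^esub> t \<in> W" by blast
    let ?y = "b' \<oplus>\<^bsub>M\<^esub> r \<odot>\<^bsub>M\<^esub> t"
    note c = cA[OF b] cA[OF b'(1)] smult_closed[OF r t]
    \<comment> \<open>Subtracting an element of \<open>W\<close> with the same coefficient leaves b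
      - b', which lies in \<open>A\<close> and in \<open>K\<close>.\<close>
    have eq: "b \<oplus>\<^bsub>M\<^esub> r \<odot>\<^bsub>M\<^esub> t = (b \<ominus>\<^bsub>M\<^esub> b') \<oplus>\<^bsub>M\<^esub> ?y"
      using c by (simp add: a_minus_def M.a_assoc M.r_neg1)
    have "(b \<ominus>\<^bsub>M\<^esub> b') \<oplus>\<^bsub>M\<^esub> ?y \<ominus>\<^bsub>M\<^esub> ?y \<in> K"
      by (rule submodule_minus[OF K]) (use x eq WK b'(2) in auto)
    then have "b \<ominus>\<^bsub>M\<^esub> b' \<in> K" using c by (simp add: M.add_minus_cancel)
    then have "b \<ominus>\<^bsub>M\<^esub> b' \<in> W" using submodule_minus[OF A b b'(1)] sub by blast
    then show ?thesis unfolding eq using submodule_add[OF W _ b'(2)] by blast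
  qed
  have "finite G" using X(2) by (simp add: G_def)
  moreover have "K \<inter> {a \<oplus>\<^bsub>M\<^esub> r \<odot>\<^bsub>M\<^esub> t | a r. a \<in> A \<and> r \<in> carrier R} \<subseteq> W" using mem by blast
  ultimately show thesis using that GK unfolding W_def by blast
qed

text \<open>The elements of \<open>T\<close> are adjoined one at a time; each costs finitely many
  new generators of the part in \<open>K\<close>, hence countably many altogether.\<close>

lemma (in left_module) noetherian_countable_step:
  assumes noeth: "left_noetherian R" and A: "submodule A R M" and K: "submodule K R M"
    and T: "T \<subseteq> carrier M" "countable T"
  obtains G where "countable G" "G \<subseteq> K"
    "K \<inter> (\<lambda>N. submodule N R M) hull (A \<union> T) \<subseteq> (\<lambda>N. submodule N R M) hull (K \<inter> A \<union> G)"
proof -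
  \<comment> \<open>Zero is included so that an enumeration exists even for empty
    \<open>T\<close>.\<close>
  define t where "t = from_nat_into (insert \<zero>\<^bsub>M\<^esub> T)"
  have ran: "range t = insert \<zero>\<^bsub>M\<^esub> T" unfolding t_def using T(2) by (simp add: range_from_nat_into)
  then have t: "t j \<in> carrier M" for j using T(1) by (metis M.zero_closed insertE rangeI subsetD)
  \<comment> \<open>\<open>B j\<close> is A + R t_0 + ... + R t_(j-1); the union of this chain
    contains the hull of \<open>A\<close> and \<open>T\<close>.\<close>
  define B where "B = rec_nat A (\<lambda>j C. {b \<oplus>\<^bsub>M\<^esub> r \<odot>\<^bsub>M\<^esub> t j | b r. b \<in> C \<and> r \<in> carrier R})"
  have B0: "B 0 = A"
    and BS: "B (Suc j) = {b \<oplus>\<^bsub>M\<^esub> r \<odot>\<^bsub>M\<^esub> t j | b r. b \<in> B j \<and> r \<in> carrier R}" for j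
    by (simp_all add: B_def)
  have sub: "submodule (B j) R M" for j
    by (induction j) (simp_all only: B0 A BS submodule_sum_cyclic t)
  have step: "B j \<subseteq> B (Suc j)" for j
  proof
    fix b assume b: "b \<in> B j"
    then have "b = b \<oplus>\<^bsub>M\<^esub> \<zero> \<odot>\<^bsub>M\<^esub> t j" using submodule_subset[OF sub b] by (simp add: smult_l_zero t)
    then show "b \<in> B (Suc j)" unfolding BS using b R.zero_closed by blast
  qed
  have mono: "B i \<subseteq> B j" if "i \<le> j" for i j
    using step that by (rule lift_Suc_mono_le)
  have tB: "t j \<in> B (Suc j)" for j
  proof -
    have "t j = \<zero>\<^bsub>M\<^esub> \<oplus>\<^bsub>M\<^esub> \<one> \<odot>\<^bsub>M\<^esub> t j" by (simp add: t)
    then show ?thesis unfolding BS using submodule_zero[OF sub] R.one_closed by blast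
  qed
  have "submodule (\<Union>(range B)) R M"
  proof (rule submodule_Union_chain)
    fix H K assume "H \<in> range B" "K \<in> range B"
    then obtain i j where "H = B i" "K = B j" by blast
    then show "H \<subseteq> K \<or> K \<subseteq> H" using mono linear[of i j] by blast
  qed (use sub in auto)
  moreover have "A \<union> T \<subseteq> \<Union>(range B)"
  proof -
    have "x \<in> \<Union>(range B)" if "x \<in> T" for x
    proof -
      from that ran obtain j where "x = t j" by (metis insertI2 rangeE)
      then show ?thesis using tB by blast
    qed
    then show ?thesis using B0 by blast
  qed
  ultimately have hull: "(\<lambda>N. submodule N R M) hull (A \<union> T) \<subseteq> \<Union>(range B)"
    by (simp add: hull_minimal)
  have "\<forall>j. \<exists>G. finite G \<and> G \<subseteq> K \<and> K \<inter> B (Suc j) \<subseteq> (\<lambda>N. submodule N R M) hull (K \<inter> B j \<union> G)"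
    (is "\<forall>j. ?ex j")
  proof
    show "?ex j" for j
      by (rule noetherian_cyclic_step[OF noeth sub[of j] K t[of j], folded BS]) blast
  qed
  then obtain G where G: "\<And>j. finite (G j)" "\<And>j. G j \<subseteq> K"
      "\<And>j. K \<inter> B (Suc j) \<subseteq> (\<lambda>N. submodule N R M) hull (K \<inter> B j \<union> G j)"
    unfolding choice_iff by blast
  let ?W = "(\<lambda>N. submodule N R M) hull (K \<inter> A \<union> \<Union>(range G))"
  have W: "submodule ?W R M"
    by (rule submodule_hull) (use G(2) submodule_subset[OF K] in blast)
  have "K \<inter> B j \<subseteq> ?W" for j
  proof (induction j)
    case 0
    show ?case by (auto simp: B0 intro: hull_inc)
  next
    case (Suc j)
    have "(\<lambda>N. submodule N R M) hull (K \<inter> B j \<union> G j) \<subseteq> ?W"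
      by (rule hull_minimal) (use Suc.IH W in \<open>auto intro: hull_inc\<close>)
    then show ?case using G(3) by blast
  qed
  then have "K \<inter> (\<lambda>N. submodule N R M) hull (A \<union> T) \<subseteq> ?W" using hull by blast
  moreover have "countable (\<Union>(range G))" using G(1) by (auto intro: countable_finite)
  moreover have "\<Union>(range G) \<subseteq> K" using G(2) by blast
  ultimately show thesis using that by blast
qed

section \<open>Support-closed exact subcomplexes of a projective resolution\<close>

text \<open>The resolution is indexed by all natural numbers, so that no condition has a special
  case at the top degree. Finite length enters later, as the hypothesis that
  \<open>P (Suc n)\<close> is zero. The support functions are parameters because goodness must refer
  to one fixed choice in every degree.\<close>

locale projective_resolution =
  fixes R :: "('a, 'r) ring_scheme" and P :: "nat \<Rightarrow> ('a, 'p) module" and d :: "nat \<Rightarrow> 'p \<Rightarrow> 'p"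
    and e :: "'p \<Rightarrow> 'm" and M :: "('a, 'm) module" and supp :: "nat \<Rightarrow> 'p \<Rightarrow> 'p set"
  assumes noeth: "left_noetherian R"
    and module_M: "left_module R M" and projective: "\<And>k. projective_module R (P k)"
    and e_hom: "e \<in> left_module_hom R (P 0) M" and e_surj: "e ` carrier (P 0) = carrier M"
    and d_hom: "\<And>k. d k \<in> left_module_hom R (P (Suc k)) (P k)"
    and exact_0: "d 0 ` carrier (P (Suc 0)) = {x \<in> carrier (P 0). e x = \<zero>\<^bsub>M\<^esub>}"
    and exact_Suc: "\<And>k. d (Suc k) ` carrier (P (Suc (Suc k))) =
      {x \<in> carrier (P (Suc k)). d k x = \<zero>\<^bsub>P k\<^esub>}"
    and support: "\<And>k. support_function R (P k) (supp k)"
begin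

lemma supp_finite: "x \<in> carrier (P k) \<Longrightarrow> finite (supp k x) \<and> supp k x \<subseteq> carrier (P k)"
  and supp_zero: "supp k \<zero>\<^bsub>P k\<^esub> = {}"
  and supp_add: "\<lbrakk>x \<in> carrier (P k); y \<in> carrier (P k)\<rbrakk> \<Longrightarrow>
    supp k (x \<oplus>\<^bsub>P k\<^esub> y) \<subseteq> supp k x \<union> supp k y"
  and supp_smult: "\<lbrakk>a \<in> carrier R; x \<in> carrier (P k)\<rbrakk> \<Longrightarrow> supp k (a \<odot>\<^bsub>P k\<^esub> x) \<subseteq> supp k x"
  and supp_retraction: "\<lbrakk>submodule A R (P k); \<And>x. x \<in> A \<Longrightarrow> supp k x \<subseteq> A\<rbrakk> \<Longrightarrow>
    \<exists>\<rho>\<in>left_module_hom R (P k) (P k\<lparr>carrier := A\<rparr>). \<forall>x\<in>A. \<rho> x = x"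
  using support[of k] unfolding support_function_def by simp_all

lemma module_P: "left_module R (P k)"
  using projective by (simp add: projective_module_def)

sublocale P: left_module R "P k" for k by (rule module_P)
sublocale M: left_module R M by (rule module_M)

abbreviation "span k X \<equiv> (\<lambda>N. submodule N R (P k)) hull X"

definition cycles :: "nat \<Rightarrow> 'p set" where
  "cycles k = (case k of 0 \<Rightarrow> {x \<in> carrier (P 0). e x = \<zero>\<^bsub>M\<^esub>}
     | Suc j \<Rightarrow> {x \<in> carrier (P k). d j x = \<zero>\<^bsub>P j\<^esub>})"

text \<open>Closure under supports makes \<open>A k\<close> a direct summand of \<open>P k\<close>.
  The last two conjuncts are exactness in every degree; for k = 0 the cycles are the kernel of
  \<open>e\<close>, so \<open>A\<close> resolves the image of \<open>A 0\<close> in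
  \<open>M\<close>.\<close>

definition good :: "(nat \<Rightarrow> 'p set) \<Rightarrow> bool" where
  "good A \<longleftrightarrow> (\<forall>k. submodule (A k) R (P k) \<and> (\<forall>x\<in>A k. supp k x \<subseteq> A k) \<and>
     d k ` A (Suc k) \<subseteq> A k \<and> cycles k \<inter> A k \<subseteq> d k ` A (Suc k))"

lemma goodD:
  assumes "good A"
  shows "submodule (A k) R (P k)" and "x \<in> A k \<Longrightarrow> supp k x \<subseteq> A k"
    and "d k ` A (Suc k) \<subseteq> A k" and "cycles k \<inter> A k \<subseteq> d k ` A (Suc k)"
  using assms by (simp_all add: good_def)

lemma boundaries: "d k ` carrier (P (Suc k)) = cycles k"
  using exact_0 exact_Suc by (cases k) (simp_all add: cycles_def)

lemma submodule_cycles: "submodule (cycles k) R (P k)"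
  unfolding boundaries[symmetric]
  by (rule submodule_image[OF module_P module_P d_hom P.submodule_carrier])

lemma good_zero: "good (\<lambda>k. {\<zero>\<^bsub>P k\<^esub>})"
  unfolding good_def using left_module_hom_zero[OF module_P module_P d_hom]
  by (auto simp: P.submodule_zero_set supp_zero)

text \<open>The conditions on supports, \<open>d\<close> and cycles concern one element at a time
  and are checked in one member; the chain condition provides closure under addition.\<close>

lemma good_Union:
  assumes ne: "\<A> \<noteq> {}" and good: "\<And>A. A \<in> \<A> \<Longrightarrow> good A"
    and chain: "\<And>A B. \<lbrakk>A \<in> \<A>; B \<in> \<A>\<rbrakk> \<Longrightarrow> A \<le> B \<or> B \<le> A"
  shows "good (\<lambda>k. \<Union>A\<in>\<A>. A k)"
  unfolding good_def
proof (intro allI conjI ballI)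
  fix k
  show "submodule (\<Union>A\<in>\<A>. A k) R (P k)"
  proof (rule P.submodule_Union_chain)
    show "H \<subseteq> K \<or> K \<subseteq> H" if "H \<in> (\<lambda>A. A k) ` \<A>" "K \<in> (\<lambda>A. A k) ` \<A>" for H K
      using that chain by (auto simp: le_fun_def; blast)
  qed (use ne good in \<open>auto simp: good_def\<close>)
  show "supp k x \<subseteq> (\<Union>A\<in>\<A>. A k)" if "x \<in> (\<Union>A\<in>\<A>. A k)" for x
    using that goodD(2)[OF good] by fast
  show "d k ` (\<Union>A\<in>\<A>. A (Suc k)) \<subseteq> (\<Union>A\<in>\<A>. A k)"
    using goodD(3)[OF good] by fast
  show "cycles k \<inter> (\<Union>A\<in>\<A>. A k) \<subseteq> d k ` (\<Union>A\<in>\<A>. A (Suc k))"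
  proof
    fix x assume "x \<in> cycles k \<inter> (\<Union>A\<in>\<A>. A k)"
    then obtain A where "A \<in> \<A>" "x \<in> cycles k \<inter> A k" by blast
    then show "x \<in> d k ` (\<Union>A\<in>\<A>. A (Suc k))" using goodD(4)[OF good, of A k] by blast
  qed
qed

text \<open>Filling a cycle in degree k adds elements in degree k + 1, which bring new supports, new
  boundaries and new cycles; hence the iteration. Supports and boundaries need to be added only for
  the countable generating family \<open>T\<close>, not for all of its span over
  \<open>A\<close>.\<close>

lemma good_extend:
  assumes A: "good A" and S: "S \<subseteq> carrier (P 0)" "countable S"
  obtains B T where "good B" "A \<le> B" "S \<subseteq> B 0"
    "\<And>k. T k \<subseteq> carrier (P k)" "\<And>k. countable (T k)" "\<And>k. B k = span k (A k \<union> T k)"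
proof -
  note A_sub = goodD(1)[OF A] and A_supp = goodD(2)[OF A] and A_d = goodD(3)[OF A]
    and A_ex = goodD(4)[OF A]
  define ok where "ok T \<longleftrightarrow> (\<forall>k. T k \<subseteq> carrier (P k) \<and> countable (T k))" for T :: "nat \<Rightarrow> 'p set"
  define B where "B T k = span k (A k \<union> T k)" for T :: "nat \<Rightarrow> 'p set" and k
  have AT: "A k \<union> T k \<subseteq> carrier (P k)" if "ok T" for T k
    using that submodule_subset[OF A_sub] unfolding ok_def by blast
  have B_sub: "submodule (B T k) R (P k)" if "ok T" for T k
    unfolding B_def by (rule P.submodule_hull[OF AT[OF that]])
  have B_least: "B T k \<subseteq> N" if "A k \<union> T k \<subseteq> N" "submodule N R (P k)" for T k N
    unfolding B_def using that by (rule hull_minimal)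
  have B_mono: "B T k \<subseteq> B T' k" if "T k \<subseteq> T' k" for T T' k
    unfolding B_def using that by (intro hull_mono) blast
  have B_sup: "A k \<subseteq> B T k" "T k \<subseteq> B T k" for T k
    unfolding B_def using hull_subset[of "A k \<union> T k"] by blast+
  \<comment> \<open>The cycles in \<open>B T k\<close> are generated by the cycles in
    \<open>A k\<close>, which are boundaries of elements of \<open>A (Suc k)\<close>, and a
    countable set \<open>G\<close>. With \<open>H\<close> a countable set of preimages of
    \<open>G\<close>, all these generators become boundaries.\<close>
  have preimages: "\<exists>H. H \<subseteq> carrier (P (Suc k)) \<and> countable H \<and>
      cycles k \<inter> B T k \<subseteq> d k ` span (Suc k) (A (Suc k) \<union> H)" if "ok T" for T k
  proof -
    have T: "T k \<subseteq> carrier (P k)" "countable (T k)" using that by (auto simp: ok_def)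
    obtain G where G: "countable G" "G \<subseteq> cycles k"
        "cycles k \<inter> B T k \<subseteq> span k (cycles k \<inter> A k \<union> G)"
      unfolding B_def
      by (rule P.noetherian_countable_step[OF noeth A_sub[of k] submodule_cycles[of k] T])
    have "\<exists>H. H \<subseteq> carrier (P (Suc k)) \<and> countable H \<and> G = d k ` H"
      using G(1,2) countable_subset_image[of G "d k" "carrier (P (Suc k))"]
      by (auto simp: boundaries)
    then obtain H where H: "H \<subseteq> carrier (P (Suc k))" "countable H" "G = d k ` H" by blast
    let ?X = "A (Suc k) \<union> H"
    have X: "?X \<subseteq> carrier (P (Suc k))" using H(1) submodule_subset[OF A_sub] by blast
    have "span k (cycles k \<inter> A k \<union> G) \<subseteq> d k ` span (Suc k) ?X"
    proof (rule hull_minimal)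
      show "cycles k \<inter> A k \<union> G \<subseteq> d k ` span (Suc k) ?X"
        using A_ex[of k] H(3) hull_subset[of ?X] by blast
      show "submodule (d k ` span (Suc k) ?X) R (P k)"
        by (rule submodule_image[OF module_P module_P d_hom P.submodule_hull[OF X]])
    qed
    then show ?thesis using G(3) H(1,2) by blast
  qed
  have step: "\<exists>T'. ok T' \<and> (\<forall>k. T k \<subseteq> T' k \<and> (\<forall>x\<in>T k. supp k x \<subseteq> T' k) \<and> d k ` T (Suc k) \<subseteq> T' k \<and>
      cycles k \<inter> B T k \<subseteq> d k ` B T' (Suc k))" if T: "ok T" for T
  proof -
    obtain H where H: "\<And>k. H k \<subseteq> carrier (P (Suc k))" "\<And>k. countable (H k)"
        "\<And>k. cycles k \<inter> B T k \<subseteq> d k ` span (Suc k) (A (Suc k) \<union> H k)"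
      using preimages[OF T] by metis
    \<comment> \<open>The preimages \<open>H j\<close> of cycles in degree j live in degree j + 1,
      whence the shift; degree 0 receives none.\<close>
    define T' where "T' k = T k \<union> (\<Union>x\<in>T k. supp k x) \<union> d k ` T (Suc k) \<union>
      (case k of 0 \<Rightarrow> {} | Suc j \<Rightarrow> H j)" for k
    have Tk: "T k \<subseteq> carrier (P k)" "countable (T k)" for k using T by (auto simp: ok_def)
    have "T' k \<subseteq> carrier (P k) \<and> countable (T' k)" for k
    proof
      have "supp k x \<subseteq> carrier (P k)" "countable (supp k x)" if "x \<in> T k" for x
        using supp_finite Tk(1) that by (meson subsetD countable_finite)+
      moreover have "d k ` T (Suc k) \<subseteq> carrier (P k)"
        using left_module_homD(1)[OF d_hom] Tk(1) by blast
      ultimately show "T' k \<subseteq> carrier (P k)" "countable (T' k)"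
        using Tk H(1,2) by (auto simp: T'_def split: nat.splits)
    qed
    moreover have "cycles k \<inter> B T k \<subseteq> d k ` B T' (Suc k)" for k
    proof -
      have "span (Suc k) (A (Suc k) \<union> H k) \<subseteq> B T' (Suc k)"
        unfolding B_def by (rule hull_mono) (auto simp: T'_def)
      then show ?thesis using H(3) by blast
    qed
    ultimately show ?thesis by (intro exI[of _ T']) (auto simp: ok_def T'_def)
  qed
  define T0 where "T0 k = (if k = 0 then S else {})" for k :: nat
  have "ok T0" using S by (simp add: ok_def T0_def)
  define nxt where "nxt T = (SOME T'. ok T' \<and> (\<forall>k. T k \<subseteq> T' k \<and> (\<forall>x\<in>T k. supp k x \<subseteq> T' k) \<and>
      d k ` T (Suc k) \<subseteq> T' k \<and> cycles k \<inter> B T k \<subseteq> d k ` B T' (Suc k)))" for T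
  note nxt = someI_ex[OF step, folded nxt_def]
  define T where "T j = (nxt ^^ j) T0" for j
  have TS: "T (Suc j) = nxt (T j)" and T0: "T 0 = T0" for j by (simp_all add: T_def)
  have ok: "ok (T j)" for j
    by (induction j) (simp_all add: T0 TS \<open>ok T0\<close> nxt)
  have T: "T j k \<subseteq> T (Suc j) k" "x \<in> T j k \<Longrightarrow> supp k x \<subseteq> T (Suc j) k"
      "d k ` T j (Suc k) \<subseteq> T (Suc j) k" "cycles k \<inter> B (T j) k \<subseteq> d k ` B (T (Suc j)) (Suc k)" for j k x
    using nxt[OF ok[of j], folded TS] by blast+
  define U where "U k = (\<Union>j. T j k)" for k
  have Uok: "ok U" using ok by (auto simp: ok_def U_def)
  have TU: "T j k \<subseteq> U k" for j k by (auto simp: U_def)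
  note U_sub = B_sub[OF Uok] and c = submodule_subset[OF B_sub[OF Uok]]
  have T_mono: "T i k \<subseteq> T j k" if "i \<le> j" for i j k
    using T(1) that by (rule lift_Suc_mono_le)
  \<comment> \<open>The span of the limit is exhausted by the spans of the stages. So each cycle in
    \<open>B U k\<close> appears at some stage j and is filled at stage j + 1.\<close>
  have BU: "B U k \<subseteq> (\<Union>j. B (T j) k)" for k
  proof (rule B_least)
    have "U k \<subseteq> (\<Union>j. B (T j) k)" unfolding U_def by (intro UN_mono B_sup) simp
    then show "A k \<union> U k \<subseteq> (\<Union>j. B (T j) k)" using B_sup(1)[of k "T 0"] by blast
    show "submodule (\<Union>j. B (T j) k) R (P k)"
    proof (rule P.submodule_Union_chain)
      fix H K assume "H \<in> range (\<lambda>j. B (T j) k)" "K \<in> range (\<lambda>j. B (T j) k)"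
      then obtain i j where "H = B (T i) k" "K = B (T j) k" by blast
      then show "H \<subseteq> K \<or> K \<subseteq> H" 
        using B_mono[of "T i" k "T j"] B_mono[of "T j" k "T i"] T_mono[of i j k] T_mono[of j i k]
          linear[of i j] by auto
    qed (use B_sub[OF ok] in auto)
  qed
  have "good (B U)"
    unfolding good_def
  proof (intro allI conjI)
    fix k
    show "submodule (B U k) R (P k)" by (rule U_sub)
    \<comment> \<open>By subadditivity the elements with support in \<open>B U k\<close> form a
      submodule, so only the generators have to be checked. The same device with a preimage under
      \<open>d k\<close> handles boundaries.\<close>
    have "B U k \<subseteq> {x \<in> carrier (P k). supp k x \<subseteq> B U k}"
    proof (rule B_least)
      show "A k \<union> U k \<subseteq> {x \<in> carrier (P k). supp k x \<subseteq> B U k}"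
      proof
        fix x assume x: "x \<in> A k \<union> U k"
        have "supp k x \<subseteq> U k" if "x \<in> T j k" for j using T(2)[OF that] TU[of "Suc j" k] by blast
        then have "supp k x \<subseteq> A k \<union> U k" using x A_supp[of x k] by (auto simp: U_def)
        then show "x \<in> {x \<in> carrier (P k). supp k x \<subseteq> B U k}"
          using B_sup(1)[of k U] B_sup(2)[of U k] c[of x k] x by blast
      qed
      show "submodule {x \<in> carrier (P k). supp k x \<subseteq> B U k} R (P k)"
      proof (rule P.left_submoduleI)
        show "x \<oplus>\<^bsub>P k\<^esub> y \<in> {x \<in> carrier (P k). supp k x \<subseteq> B U k}"
          if "x \<in> {x \<in> carrier (P k). supp k x \<subseteq> B U k}" "y \<in> {x \<in> carrier (P k). supp k x \<subseteq> B U k}" for x y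
          using that supp_add[of x k y] by auto
        show "a \<odot>\<^bsub>P k\<^esub> x \<in> {x \<in> carrier (P k). supp k x \<subseteq> B U k}"
          if "a \<in> carrier R" "x \<in> {x \<in> carrier (P k). supp k x \<subseteq> B U k}" for a x
          using that supp_smult[of a x k] by auto
      qed (auto simp: supp_zero)
    qed
    then show "\<forall>x\<in>B U k. supp k x \<subseteq> B U k" by blast
    have "B U (Suc k) \<subseteq> {x \<in> carrier (P (Suc k)). d k x \<in> B U k}"
    proof (rule B_least)
      show "A (Suc k) \<union> U (Suc k) \<subseteq> {x \<in> carrier (P (Suc k)). d k x \<in> B U k}"
      proof
        fix x assume x: "x \<in> A (Suc k) \<union> U (Suc k)"
        have "d k x \<in> U k" if "x \<in> T j (Suc k)" for j
          using that T(3)[of k j] TU[of "Suc j" k] by blast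
        then have "d k x \<in> A k \<union> U k" using x A_d[of k] by (auto simp: U_def)
        then show "x \<in> {x \<in> carrier (P (Suc k)). d k x \<in> B U k}" 
          using B_sup(1)[of k U] B_sup(2)[of U k] AT[OF Uok, of "Suc k"] x by blast
      qed
      show "submodule {x \<in> carrier (P (Suc k)). d k x \<in> B U k} R (P (Suc k))"
        by (rule submodule_vimage[OF module_P module_P d_hom U_sub])
    qed
    then show "d k ` B U (Suc k) \<subseteq> B U k" by blast
    show "cycles k \<inter> B U k \<subseteq> d k ` B U (Suc k)"
    proof
      fix x assume x: "x \<in> cycles k \<inter> B U k"
      then obtain j where "x \<in> B (T j) k" using BU by blast
      then have "x \<in> d k ` B (T (Suc j)) (Suc k)" using x T(4) by blast
      then show "x \<in> d k ` B U (Suc k)"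
        using B_mono[of "T (Suc j)" "Suc k" U] TU[of "Suc j" "Suc k"] by blast
    qed
  qed
  moreover have "S \<subseteq> B U 0" using B_sup(2)[of U 0] TU[of 0 0] by (auto simp: T0 T0_def)
  ultimately show thesis
    using B_sup(1) Uok by (intro that[of "B U" U] le_funI) (simp_all add: ok_def B_def)
qed

end

section \<open>The quotient complex of two good families\<close>

context projective_resolution
begin

lemma good_retraction:
  assumes "good A"
  obtains \<rho> where "\<rho> \<in> left_module_hom R (P k) (P k)"
    "\<And>x. x \<in> carrier (P k) \<Longrightarrow> \<rho> x \<in> A k" "\<And>x. x \<in> A k \<Longrightarrow> \<rho> x = x"
proof -
  obtain \<rho> where \<rho>: "\<rho> \<in> left_module_hom R (P k) (P k\<lparr>carrier := A k\<rparr>)" "\<forall>x\<in>A k. \<rho> x = x"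
    using supp_retraction[OF goodD(1,2)[OF assms]] by blast
  have "\<rho> \<in> left_module_hom R (P k) (P k)"
    by (rule left_module_homI)
      (use left_module_homD[OF \<rho>(1)] submodule_subset[OF goodD(1)[OF assms]] in auto)
  then show thesis using that left_module_homD(1)[OF \<rho>(1)] \<rho>(2) by auto
qed

text \<open>The quotient complex B/A is realised inside \<open>P\<close> by complements
  \<open>C k\<close> of \<open>A k\<close> in \<open>B k\<close>, with differential \<open>d\<close>
  followed by the projection to the complement. It is exact because \<open>A\<close> and
  \<open>B\<close> both are. The target is any \<open>Y\<close> presented by a surjection
  \<open>\<psi>\<close> with kernel the image of \<open>A 0\<close>, which covers submodules of
  \<open>M\<close> as well as quotients.\<close>

lemma subquotient_P_aleph0:
  fixes Y :: "('a, 'y) module"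
  assumes A: "good A" and B: "good B" and AB: "A \<le> B"
    and T: "\<And>k. T k \<subseteq> carrier (P k)" "\<And>k. countable (T k)" and BT: "\<And>k. B k = span k (A k \<union> T k)"
    and fin: "carrier (P (Suc n)) = {\<zero>\<^bsub>P (Suc n)\<^esub>}"
    and Y: "left_module R Y" and \<psi>: "\<psi> \<in> left_module_hom R (M\<lparr>carrier := e ` B 0\<rparr>) Y"
    and \<psi>_surj: "\<psi> ` e ` B 0 = carrier Y"
    and \<psi>_ker: "\<And>y. y \<in> e ` B 0 \<Longrightarrow> \<psi> y = \<zero>\<^bsub>Y\<^esub> \<longleftrightarrow> y \<in> e ` A 0"
  shows "P_aleph0 R n Y"
proof -
  note A_sub = goodD(1)[OF A] and B_sub = goodD(1)[OF B]
  have AkBk: "x \<in> B k" if "x \<in> A k" for k x using AB that by (auto simp: le_fun_def)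
  note Bc = submodule_subset[OF B_sub]
  have Ac: "x \<in> carrier (P k)" if "x \<in> A k" for k x using Bc[OF AkBk[OF that]] .
  have "\<forall>k. \<exists>\<rho>. \<rho> \<in> left_module_hom R (P k) (P k) \<and> (\<forall>x\<in>carrier (P k). \<rho> x \<in> A k) \<and> (\<forall>x\<in>A k. \<rho> x = x)"
    using good_retraction[OF A] by metis
  then obtain \<rho> where \<rho>: "\<And>k. \<rho> k \<in> left_module_hom R (P k) (P k)"
      and \<rho>A: "\<And>k x. x \<in> carrier (P k) \<Longrightarrow> \<rho> k x \<in> A k" and \<rho>_id: "\<And>k x. x \<in> A k \<Longrightarrow> \<rho> k x = x"
    unfolding choice_iff by blast
  \<comment> \<open>\<open>q k\<close> is the projection with kernel exactly \<open>A k\<close>; on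
    \<open>B k\<close> it has image \<open>C k\<close> and is idempotent.\<close>
  define q where "q k x = x \<ominus>\<^bsub>P k\<^esub> \<rho> k x" for k x
  define C where "C k = q k ` B k" for k
  have q_hom: "q k \<in> left_module_hom R (P k) (P k)" for k
  proof (rule left_module_homI)
    fix x y assume xy: "x \<in> carrier (P k)" "y \<in> carrier (P k)"
    note c = xy left_module_homD(1)[OF \<rho>[of k] xy(1)] left_module_homD(1)[OF \<rho>[of k] xy(2)]
    show "q k x \<in> carrier (P k)" using c by (simp add: q_def)
    show "q k (x \<oplus>\<^bsub>P k\<^esub> y) = q k x \<oplus>\<^bsub>P k\<^esub> q k y"
      using c by (simp add: q_def left_module_homD(2)[OF \<rho>] a_minus_def P.M.minus_add P.M.a_ac)
  next
    fix a x assume a: "a \<in> carrier R" and x: "x \<in> carrier (P k)"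
    note c = x left_module_homD(1)[OF \<rho>[of k] x]
    have "a \<odot>\<^bsub>P k\<^esub> (\<ominus>\<^bsub>P k\<^esub> \<rho> k x) = \<ominus>\<^bsub>P k\<^esub> (a \<odot>\<^bsub>P k\<^esub> \<rho> k x)"
      by (rule P.M.minus_equality[symmetric])
        (use a c in \<open>simp_all add: P.smult_r_distr[symmetric] P.M.l_neg P.smult_r_zero\<close>)
    then show "q k (a \<odot>\<^bsub>P k\<^esub> x) = a \<odot>\<^bsub>P k\<^esub> q k x"
      using a c by (simp add: q_def left_module_homD(3)[OF \<rho>] a_minus_def P.smult_r_distr)
  qed
  have q_zero: "q k x = \<zero>\<^bsub>P k\<^esub>" if "x \<in> A k" for k x
    using that Ac by (simp add: q_def \<rho>_id a_minus_def P.M.r_neg)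
  have decomp: "x = \<rho> k x \<oplus>\<^bsub>P k\<^esub> q k x" if "x \<in> carrier (P k)" for k x
    using that left_module_homD(1)[OF \<rho>[of k] that]
    by (simp add: q_def a_minus_def P.M.a_ac P.M.r_neg P.M.r_neg1)
  have CB: "x \<in> B k" if "x \<in> C k" for k x
    using that submodule_minus[OF B_sub _ AkBk[OF \<rho>A]] Bc by (auto simp: C_def q_def)
  note Cc = Bc[OF CB]
  have q_id: "q k x = x" if "x \<in> C k" for k x
  proof -
    obtain b where b: "b \<in> B k" "x = q k b" using \<open>x \<in> C k\<close> by (auto simp: C_def)
    note c = Bc[OF b(1)] Ac[OF \<rho>A[OF Bc[OF b(1)]]]
    have "q k b = q k (\<rho> k b) \<oplus>\<^bsub>P k\<^esub> q k (q k b)"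
      using decomp[OF c(1)] left_module_homD(2)[OF q_hom c(2), of "q k b"]
        left_module_homD(1)[OF q_hom c(1)] by metis
    then show ?thesis
      using c(1) b(2) q_zero[OF \<rho>A[OF c(1)]] left_module_homD(1)[OF q_hom[of k]] by simp
  qed
  have qC: "q k x \<in> C k" if "x \<in> B k" for k x using that by (auto simp: C_def)
  have C_sub: "submodule (C k) R (P k)" for k
    unfolding C_def by (rule submodule_image[OF module_P module_P q_hom B_sub])
  let ?Q = "\<lambda>k. P k\<lparr>carrier := C k\<rparr>"
  have module_Q: "left_module R (?Q k)" for k by (rule P.left_module_submodule[OF C_sub])
  \<comment> \<open>\<open>C k\<close> is a retract of \<open>P k\<close>: project to the direct
    summand \<open>B k\<close>, then apply \<open>q k\<close>.\<close>
  have proj_Q: "projective_module R (?Q k)" for k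
  proof -
    obtain \<beta> where \<beta>: "\<beta> \<in> left_module_hom R (P k) (P k)"
        "\<And>x. x \<in> carrier (P k) \<Longrightarrow> \<beta> x \<in> B k" "\<And>x. x \<in> B k \<Longrightarrow> \<beta> x = x"
      using good_retraction[OF B] by blast
    show ?thesis
    proof (rule projective_retract[OF projective module_Q, where f = "\<lambda>x. q k (\<beta> x)" and g = "\<lambda>x. x"])
      show "(\<lambda>x. q k (\<beta> x)) \<in> left_module_hom R (P k) (?Q k)"
        by (rule left_module_homI)
          (use left_module_homD[OF left_module_hom_comp[OF \<beta>(1) q_hom[of k]]] \<beta>(2) qC in auto)
      show "(\<lambda>x. x) \<in> left_module_hom R (?Q k) (P k)"
        by (rule left_module_homI) (auto simp: Cc)
      show "q k (\<beta> y) = y" if "y \<in> carrier (?Q k)" for y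
        using that by (simp add: \<beta>(3) CB q_id)
    qed
  qed
  have cg_Q: "countably_generated R (?Q k)" for k
  proof -
    have AT: "A k \<union> T k \<subseteq> carrier (P k)" using T(1) Ac by blast
    \<comment> \<open>The possibly uncountable generating set \<open>A k\<close> collapses to zero,
      so only the images of \<open>T k\<close> count.\<close>
    have "q k ` (A k \<union> T k) \<subseteq> insert \<zero>\<^bsub>P k\<^esub> (q k ` T k)" using q_zero by blast
    then have "countable (q k ` (A k \<union> T k))"
      using T(2) by (meson countable_image countable_insert countable_subset)
    moreover have sub: "q k ` (A k \<union> T k) \<subseteq> C k"
      unfolding C_def BT by (intro image_mono hull_subset)
    moreover have "span k (q k ` (A k \<union> T k)) = C k"
      unfolding C_def BT by (rule hull_image[OF module_P module_P q_hom AT])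
    ultimately show ?thesis
      unfolding countably_generated_def
      by (intro exI[of _ "q k ` (A k \<union> T k)"]) (simp add: P.hull_submodule_eq[OF C_sub sub])
  qed
  \<comment> \<open>\<open>D k\<close> consists of the elements that represent cycles of the
    quotient complex P/A. It equals \<open>A k\<close> + \<open>cycles k\<close>.\<close>
  define D where "D k = (case k of 0 \<Rightarrow> {x \<in> carrier (P 0). e x \<in> e ` A 0}
      | Suc j \<Rightarrow> {x \<in> carrier (P k). d j x \<in> A j})" for k
  have D_sub: "submodule (D k) R (P k)" for k
  proof (cases k)
    case 0
    then show ?thesis
      using submodule_vimage[OF module_P module_M e_hom submodule_image[OF module_P module_M e_hom A_sub]]
      by (simp add: D_def)
  next
    case (Suc j)
    then show ?thesis using submodule_vimage[OF module_P module_P d_hom A_sub] by (simp add: D_def)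
  qed
  have cycles_D: "x \<in> D k" if "x \<in> cycles k" for k x
    using that submodule_zero[OF A_sub]
      submodule_zero[OF submodule_image[OF module_P module_M e_hom A_sub]]
    by (auto simp: D_def cycles_def split: nat.splits)
  have A_D: "x \<in> D k" if "x \<in> A k" for k x
    using that Ac goodD(3)[OF A, THEN subsetD, OF imageI] by (auto simp: D_def split: nat.splits)
  have D_cycles: "\<exists>a\<in>A k. x \<ominus>\<^bsub>P k\<^esub> a \<in> cycles k" if x: "x \<in> D k" for k x
  proof (cases k)
    case 0
    then obtain a where a: "a \<in> A 0" "e x = e a" using x by (auto simp: D_def)
    have c: "x \<in> carrier (P 0)" "a \<in> carrier (P 0)" using x a Ac 0 by (auto simp: D_def)
    then have "e (x \<ominus>\<^bsub>P 0\<^esub> a) = \<zero>\<^bsub>M\<^esub>"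
      using a(2) left_module_homD(1)[OF e_hom]
      by (simp add: left_module_hom_minus[OF module_P module_M e_hom] M.M.minus_self)
    then show ?thesis using a(1) c 0 by (auto simp: cycles_def)
  next
    case (Suc j)
    have xc: "x \<in> carrier (P (Suc j))" and dx: "d j x \<in> A j" using x Suc by (auto simp: D_def)
    \<comment> \<open>Being a cycle that lies in \<open>A j\<close>, this boundary is also the
      boundary of some \<open>a\<close> in \<open>A (Suc j)\<close>, by exactness of
      \<open>A\<close>.\<close>
    have "d j x \<in> cycles j" using xc boundaries by blast
    then obtain a where a: "a \<in> A (Suc j)" "d j x = d j a" using dx goodD(4)[OF A, of j] by blast
    have c: "x \<in> carrier (P (Suc j))" "a \<in> carrier (P (Suc j))" using xc a Ac by auto
    then have "d j (x \<ominus>\<^bsub>P (Suc j)\<^esub> a) = \<zero>\<^bsub>P j\<^esub>"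
      using a(2) left_module_homD(1)[OF d_hom, of a j]
      by (simp add: left_module_hom_minus[OF module_P module_P d_hom] P.M.minus_self)
    then show ?thesis using a(1) c Suc by (auto simp: cycles_def)
  qed
  have exact: "(\<lambda>x. q k (d k x)) ` C (Suc k) = C k \<inter> D k" for k
  proof
    show "(\<lambda>x. q k (d k x)) ` C (Suc k) \<subseteq> C k \<inter> D k"
    proof
      fix y assume "y \<in> (\<lambda>x. q k (d k x)) ` C (Suc k)"
      then obtain x where x: "x \<in> C (Suc k)" and y: "y = q k (d k x)" by blast
      have dx: "d k x \<in> B k" using CB[OF x] goodD(3)[OF B] by blast
      have "d k x \<in> cycles k" using Cc[OF x] boundaries by blast
      then have "q k (d k x) \<in> D k"
        unfolding q_def using submodule_minus[OF D_sub cycles_D A_D[OF \<rho>A[OF Bc[OF dx]]]] by blast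
      then show "y \<in> C k \<inter> D k" using qC[OF dx] y by blast
    qed
    show "C k \<inter> D k \<subseteq> (\<lambda>x. q k (d k x)) ` C (Suc k)"
    proof
      fix x assume x: "x \<in> C k \<inter> D k"
      then obtain a where a: "a \<in> A k" "x \<ominus>\<^bsub>P k\<^esub> a \<in> cycles k" using D_cycles by blast
      have xC: "x \<in> C k" using x by blast
      \<comment> \<open>The corrected element is a genuine cycle in \<open>B k\<close>, hence d b by
        exactness of \<open>B\<close>. Applying \<open>q k\<close> recovers x, and the
        \<open>A\<close>-component of b contributes nothing since \<open>d\<close> maps
        \<open>A\<close> into \<open>A\<close>.\<close>
      have "x \<ominus>\<^bsub>P k\<^esub> a \<in> B k" using submodule_minus[OF B_sub CB[OF xC] AkBk[OF a(1)]] .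
      then obtain b where b: "b \<in> B (Suc k)" "x \<ominus>\<^bsub>P k\<^esub> a = d k b"
        using a(2) goodD(4)[OF B, of k] by blast
      note bc = Bc[OF b(1)]
      note c = Ac[OF \<rho>A[OF bc]] left_module_homD(1)[OF q_hom bc]
      have "x = q k (x \<ominus>\<^bsub>P k\<^esub> a)"
        using left_module_hom_minus[OF module_P module_P q_hom Cc[OF xC] Ac[OF a(1)]]
          q_id[OF xC] q_zero[OF a(1)] Cc[OF xC] by (simp add: a_minus_def)
      also have "\<dots> = q k (d k (\<rho> (Suc k) b \<oplus>\<^bsub>P (Suc k)\<^esub> q (Suc k) b))"
        using b(2) decomp[OF bc] by simp
      also have "\<dots> = q k (d k (\<rho> (Suc k) b)) \<oplus>\<^bsub>P k\<^esub> q k (d k (q (Suc k) b))"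
        using c left_module_homD[OF left_module_hom_comp[OF d_hom q_hom]] by simp
      also have "q k (d k (\<rho> (Suc k) b)) = \<zero>\<^bsub>P k\<^esub>"
        using goodD(3)[OF A, of k] \<rho>A[OF bc] by (intro q_zero) blast
      also have "\<zero>\<^bsub>P k\<^esub> \<oplus>\<^bsub>P k\<^esub> q k (d k (q (Suc k) b)) = q k (d k (q (Suc k) b))"
        using c left_module_homD(1)[OF left_module_hom_comp[OF d_hom q_hom]] by simp
      finally show "x \<in> (\<lambda>x. q k (d k x)) ` C (Suc k)" using qC[OF b(1)] by blast
    qed
  qed
  have q_zero_iff: "q k x = \<zero>\<^bsub>P k\<^esub> \<longleftrightarrow> x \<in> A k" if "x \<in> carrier (P k)" for k x
    using q_zero \<rho>A[OF that] decomp[OF that] left_module_homD(1)[OF \<rho>[of k] that]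
    by (metis P.M.r_zero)
  have dC: "d k x \<in> B k" if "x \<in> C (Suc k)" for k x using CB[OF that] goodD(3)[OF B] by blast
  have "resolution R n ?Q (\<lambda>k x. q k (d k x)) (\<lambda>x. \<psi> (e x)) Y"
    unfolding resolution_def
  proof (intro conjI allI impI)
    show "(\<lambda>x. \<psi> (e x)) \<in> left_module_hom R (?Q 0) Y"
      by (rule left_module_homI)
        (use left_module_homD[OF \<psi>] left_module_homD[OF e_hom] CB Cc in auto)
    show "(\<lambda>x. \<psi> (e x)) ` carrier (?Q 0) = carrier Y"
    proof
      show "carrier Y \<subseteq> (\<lambda>x. \<psi> (e x)) ` carrier (?Q 0)"
      proof
        fix y assume "y \<in> carrier Y"
        then obtain b where b: "b \<in> B 0" "y = \<psi> (e b)" using \<psi>_surj by blast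
        note bc = Bc[OF b(1)]
        note c = Ac[OF \<rho>A[OF bc]] left_module_homD(1)[OF q_hom bc]
        have "e b = e (\<rho> 0 b) \<oplus>\<^bsub>M\<^esub> e (q 0 b)"
          using decomp[OF bc] left_module_homD(2)[OF e_hom c] by simp
        then have "y = \<psi> (e (\<rho> 0 b)) \<oplus>\<^bsub>Y\<^esub> \<psi> (e (q 0 b))"
          using b(2) left_module_homD(2)[OF \<psi>, of "e (\<rho> 0 b)" "e (q 0 b)"]
            AkBk[OF \<rho>A[OF bc]] CB[OF qC[OF b(1)]] by simp
        also have "\<psi> (e (\<rho> 0 b)) = \<zero>\<^bsub>Y\<^esub>"
          using \<psi>_ker AkBk[OF \<rho>A[OF bc]] \<rho>A[OF bc] by blast
        also have "\<zero>\<^bsub>Y\<^esub> \<oplus>\<^bsub>Y\<^esub> \<psi> (e (q 0 b)) = \<psi> (e (q 0 b))"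
          using left_module_homD(1)[OF \<psi>, of "e (q 0 b)"] CB[OF qC[OF b(1)]] Y
          by (simp add: left_module_def abelian_group_def abelian_monoid.l_zero)
        finally show "y \<in> (\<lambda>x. \<psi> (e x)) ` carrier (?Q 0)" using qC[OF b(1)] by auto
      qed
    qed (use \<psi>_surj CB in auto)
    show "(\<lambda>x. q k (d k x)) \<in> left_module_hom R (?Q (Suc k)) (?Q k)" for k
      by (rule left_module_homI)
        (use left_module_homD[OF left_module_hom_comp[OF d_hom q_hom]] qC[OF dC] Cc in auto)
    fix k assume k: "k \<le> n"
    \<comment> \<open>At the top degree the incoming term vanishes, so the general exactness
      statement turns into injectivity of the last differential.\<close>
    have "C (Suc n) = {\<zero>\<^bsub>P (Suc n)\<^esub>}"
    proof
      show "C (Suc n) \<subseteq> {\<zero>\<^bsub>P (Suc n)\<^esub>}" using Cc unfolding fin[symmetric] by (rule subsetI)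
    qed (simp add: submodule_zero[OF C_sub])
    then have "C n \<inter> D n = {\<zero>\<^bsub>P n\<^esub>}"
      unfolding exact[symmetric]
      using left_module_hom_zero[OF module_P module_P left_module_hom_comp[OF d_hom[of n] q_hom[of n]]]
      by simp
    then have "(if k < n then (\<lambda>x. q k (d k x)) ` carrier (?Q (Suc k)) else {\<zero>\<^bsub>?Q k\<^esub>}) = C k \<inter> D k"
      using k by (cases "k = n") (simp_all add: exact)
    also have "\<dots> = (case k of 0 \<Rightarrow> a_kernel (?Q 0) Y (\<lambda>x. \<psi> (e x))
        | Suc j \<Rightarrow> a_kernel (?Q k) (?Q j) (\<lambda>x. q j (d j x)))"
    proof (cases k)
      case 0
      have "x \<in> D 0 \<longleftrightarrow> \<psi> (e x) = \<zero>\<^bsub>Y\<^esub>" if "x \<in> C 0" for x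
        using \<psi>_ker[of "e x"] CB[OF that] Cc[OF that] by (auto simp: D_def)
      then show ?thesis using 0 by (auto simp: a_kernel_def')
    next
      case (Suc j)
      have "x \<in> D (Suc j) \<longleftrightarrow> q j (d j x) = \<zero>\<^bsub>P j\<^esub>" if "x \<in> C (Suc j)" for x
        using q_zero_iff[OF Bc[OF dC[OF that]]] Cc[OF that] by (auto simp: D_def)
      then show ?thesis using Suc by (auto simp: a_kernel_def')
    qed
    finally show "(if k < n then (\<lambda>x. q k (d k x)) ` carrier (?Q (Suc k)) else {\<zero>\<^bsub>?Q k\<^esub>}) =
        (case k of 0 \<Rightarrow> a_kernel (?Q 0) Y (\<lambda>x. \<psi> (e x))
        | Suc j \<Rightarrow> a_kernel (?Q k) (?Q j) (\<lambda>x. q j (d j x)))" .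
  qed (use Y module_Q in auto)
  then show ?thesis by (rule P_aleph0I) (use proj_Q cg_Q in auto)
qed

end

section \<open>Quotient modules\<close>

lemma quotient_module_projection:
  assumes L: "left_module R L" and N: "submodule N R L"
  shows left_module_quotient: "left_module R (quotient_module L N)"
    and quotient_projection_hom: "(\<lambda>x. N +>\<^bsub>L\<^esub> x) \<in> left_module_hom R L (quotient_module L N)"
    and quotient_projection_surj: "(\<lambda>x. N +>\<^bsub>L\<^esub> x) ` carrier L = carrier (quotient_module L N)"
    and quotient_projection_zero:
      "x \<in> carrier L \<Longrightarrow> N +>\<^bsub>L\<^esub> x = \<zero>\<^bsub>quotient_module L N\<^esub> \<longleftrightarrow> x \<in> N"
proof -
  interpret L: left_module R L by fact
  interpret N: abelian_subgroup N L
    by (rule abelian_subgroupI3)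
      (use N L.M.abelian_group_axioms in \<open>auto simp: additive_subgroup_def submodule_def\<close>)
  let ?Q = "quotient_module L N" and ?\<pi> = "\<lambda>x. N +>\<^bsub>L\<^esub> x"
  have eq: "?\<pi> x = ?\<pi> y" if "x \<in> ?\<pi> y" "y \<in> carrier L" for x y
    using that L.M.a_repr_independence[of x N y] N by (simp add: submodule_def)
  have add: "?\<pi> x \<oplus>\<^bsub>?Q\<^esub> ?\<pi> y = ?\<pi> (x \<oplus>\<^bsub>L\<^esub> y)" if "x \<in> carrier L" "y \<in> carrier L" for x y
    using that by (simp add: quotient_module_def N.a_rcos_sum)
  have smult: "a \<odot>\<^bsub>?Q\<^esub> ?\<pi> x = ?\<pi> (a \<odot>\<^bsub>L\<^esub> x)" if a: "a \<in> carrier R" and x: "x \<in> carrier L" for a x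
  proof -
    \<comment> \<open>The scalar action is defined as a union over the whole coset. All members give
      the same coset, because a h stays in \<open>N\<close> for h in \<open>N\<close>, so the union
      is that single coset.\<close>
    have "?\<pi> (a \<odot>\<^bsub>L\<^esub> y) = ?\<pi> (a \<odot>\<^bsub>L\<^esub> x)" if y: "y \<in> ?\<pi> x" for y
    proof (rule eq)
      obtain h where h: "h \<in> N" "y = h \<oplus>\<^bsub>L\<^esub> x" using y by (auto simp: a_r_coset_def')
      then have "a \<odot>\<^bsub>L\<^esub> y = a \<odot>\<^bsub>L\<^esub> h \<oplus>\<^bsub>L\<^esub> a \<odot>\<^bsub>L\<^esub> x"
        using a x by (simp add: L.smult_r_distr)
      then show "a \<odot>\<^bsub>L\<^esub> y \<in> ?\<pi> (a \<odot>\<^bsub>L\<^esub> x)"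
        using submodule_smult[OF N a h(1)] by (auto simp: a_r_coset_def')
    qed (use a x in simp)
    note coset = this
    have "(\<Union>y\<in>?\<pi> x. ?\<pi> (a \<odot>\<^bsub>L\<^esub> y)) = ?\<pi> (a \<odot>\<^bsub>L\<^esub> x)"
      by (rule UN_constant_eq[OF N.a_rcos_self[OF x]]) (use coset in blast)
    then show ?thesis by (simp add: quotient_module_def)
  qed
  show surj: "?\<pi> ` carrier L = carrier ?Q"
    by (simp add: quotient_module_def A_RCOSETS_def' UNION_singleton_eq_range)
  have zero: "\<zero>\<^bsub>?Q\<^esub> = ?\<pi> \<zero>\<^bsub>L\<^esub>" 
    using L.M.a_coset_add_zero[OF N.a_subset] by (simp add: quotient_module_def)
  show "left_module R ?Q" by (rule left_module_surjective_image[OF L surj zero add smult])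
  show "?\<pi> \<in> left_module_hom R L ?Q"
    by (rule left_module_homI) (use surj in \<open>auto simp: add smult\<close>)
  show "?\<pi> x = \<zero>\<^bsub>?Q\<^esub> \<longleftrightarrow> x \<in> N" if "x \<in> carrier L"
    using N.a_rcos_self[OF that] N.a_rcos_const[of x] unfolding quotient_module_def by auto
qed

section \<open>The well-order of initial segments\<close>

text \<open>The stage of the filtration at an initial segment \<open>I\<close> is the union of the steps at the
  elements of \<open>I\<close>. Indexing by segments instead of elements makes the filtration continuous, and the
  improper segment provides the stage after the last step.\<close>

locale segments =
  fixes W :: "'w rel"
  assumes W: "Well_order W" "Field W = UNIV"
begin

definition seg :: "'w set \<Rightarrow> bool" where
  "seg I \<longleftrightarrow> (\<forall>x\<in>I. \<forall>y. (y, x) \<in> W \<longrightarrow> y \<in> I)"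

definition below :: "'w \<Rightarrow> 'w set" where
  "below x = {y. (y, x) \<in> W - Id}"

definition seg_order :: "'w set rel" where
  "seg_order = {(I, J). seg I \<and> seg J \<and> I \<subseteq> J}"

lemma W_trans: "(x, y) \<in> W \<Longrightarrow> (y, z) \<in> W \<Longrightarrow> (x, z) \<in> W"
  and W_antisym: "(x, y) \<in> W \<Longrightarrow> (y, x) \<in> W \<Longrightarrow> x = y"
  and W_wf: "wf (W - Id)"
  and W_total: "(x, y) \<in> W \<or> (y, x) \<in> W"
proof -
  have "trans W" "antisym W" "refl W" "total W"
    using W unfolding order_on_defs by simp_all
  then show "(x, y) \<in> W \<Longrightarrow> (y, z) \<in> W \<Longrightarrow> (x, z) \<in> W"
    and "(x, y) \<in> W \<Longrightarrow> (y, x) \<in> W \<Longrightarrow> x = y" "(x, y) \<in> W \<or> (y, x) \<in> W"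
    by (meson transD, meson antisymD, metis UNIV_I refl_onD total_on_def)
  show "wf (W - Id)" using W unfolding order_on_defs by blast
qed

lemma below_not_self: "x \<notin> below x"
  by (simp add: below_def)

lemma seg_below: "seg (below x)"
  unfolding seg_def
proof (intro ballI allI impI)
  fix y z assume "y \<in> below x" and zy: "(z, y) \<in> W"
  then have yx: "(y, x) \<in> W" "y \<noteq> x" by (simp_all add: below_def)
  then have "z \<noteq> x" using W_antisym[OF yx(1)] zy by blast
  then show "z \<in> below x" using W_trans[OF zy yx(1)] by (simp add: below_def)
qed

lemma seg_insert_below: "seg (insert x (below x))"
  unfolding seg_def
proof (intro ballI allI impI)
  fix y z assume y: "y \<in> insert x (below x)" and zy: "(z, y) \<in> W"
  then have "(y, x) \<in> W" using W_total[of x x] by (cases "y = x") (simp_all add: below_def)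
  then show "z \<in> insert x (below x)" using W_trans[OF zy] by (simp add: below_def)
qed

lemma insert_below_subset: "seg I \<Longrightarrow> x \<in> I \<Longrightarrow> insert x (below x) \<subseteq> I"
  unfolding seg_def below_def by blast

lemma subset_below: "seg I \<Longrightarrow> x \<notin> I \<Longrightarrow> I \<subseteq> below x"
proof
  fix y assume "seg I" "x \<notin> I" "y \<in> I"
  then show "y \<in> below x" using W_total[of x y] by (auto simp: seg_def below_def)
qed

lemma seg_linear: "seg I \<Longrightarrow> seg J \<Longrightarrow> I \<subseteq> J \<or> J \<subseteq> I"
proof (rule ccontr)
  assume IJ: "seg I" "seg J" and "\<not> (I \<subseteq> J \<or> J \<subseteq> I)"
  then obtain x where "x \<in> I" "x \<notin> J" by blast
  then have "J \<subseteq> I" using subset_below[OF IJ(2), of x] insert_below_subset[OF IJ(1), of x] by blast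
  then show False using \<open>\<not> (I \<subseteq> J \<or> J \<subseteq> I)\<close> by blast
qed

lemma Field_seg_order: "Field seg_order = Collect seg"
proof
  show "Field seg_order \<subseteq> Collect seg" unfolding Field_def seg_order_def by blast
  show "Collect seg \<subseteq> Field seg_order"
  proof
    fix I assume "I \<in> Collect seg"
    then have "(I, I) \<in> seg_order" by (simp add: seg_order_def)
    then show "I \<in> Field seg_order" by (rule FieldI1)
  qed
qed

lemma under_seg_order:
  "seg J \<Longrightarrow> under seg_order J = {I. seg I \<and> I \<subseteq> J}"
  "seg J \<Longrightarrow> underS seg_order J = {I. seg I \<and> I \<subset> J}"
  by (auto simp: under_def underS_def seg_order_def)

text \<open>Let x be the least element missing from some segment J in \<open>Q\<close>; such a J is
  minimal. A smaller member of \<open>Q\<close> would miss some y in J, and J lies below x, so y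
  would be a smaller missing element. If nothing is missing, every segment in \<open>Q\<close> is
  the whole type.\<close>

lemma wf_seg_order: "wf (seg_order - Id)"
  unfolding wf_eq_minimal
proof (intro allI impI)
  fix Q :: "'w set set" and I assume I: "I \<in> Q"
  define D where "D = {x. \<exists>J\<in>Q. seg J \<and> x \<notin> J}"
  show "\<exists>z\<in>Q. \<forall>y. (y, z) \<in> seg_order - Id \<longrightarrow> y \<notin> Q"
  proof (cases "D = {}")
    case True
    then show ?thesis using I by (intro bexI[of _ I]) (auto simp: D_def seg_order_def)
  next
    case False
    then obtain x where x: "x \<in> D" "\<And>y. (y, x) \<in> W - Id \<Longrightarrow> y \<notin> D"
      using W_wf unfolding wf_eq_minimal by blast
    then obtain J where J: "J \<in> Q" "seg J" "x \<notin> J" by (auto simp: D_def)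
    have "K \<notin> Q" if "(K, J) \<in> seg_order - Id" for K
    proof
      assume "K \<in> Q"
      from that obtain y where y: "seg K" "y \<in> J" "y \<notin> K" by (auto simp: seg_order_def)
      then have "y \<in> D" using \<open>K \<in> Q\<close> by (auto simp: D_def)
      moreover have "y \<in> below x" using subset_below[OF J(2,3)] y(2) by blast
      ultimately show False using x(2) by (auto simp: below_def)
    qed
    then show ?thesis using J(1) by blast
  qed
qed

lemma Well_order_seg_order: "Well_order seg_order"
  unfolding order_on_defs Field_seg_order
proof (intro conjI wf_seg_order)
  show "total_on (Collect seg) seg_order"
    using seg_linear by (auto simp: seg_order_def total_on_def)
qed (auto simp: seg_order_def refl_on_def trans_def antisym_def)

lemma ord_zero_seg: "ord_zero seg_order I \<longleftrightarrow> I = {}"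
proof -
  have "seg {}" by (simp add: seg_def)
  then have "ord_zero seg_order I \<longleftrightarrow> seg I \<and> (\<forall>K. seg K \<longrightarrow> \<not> K \<subset> I)"
    by (auto simp: ord_zero_def Field_seg_order under_seg_order)
  then show ?thesis using \<open>seg {}\<close> by blast
qed

text \<open>For x in \<open>J\<close> but not in \<open>I\<close>, the segment closed by x lies in
  \<open>J\<close> and not in \<open>I\<close>, so it cannot be a proper part of \<open>J\<close>.
  Each successor step thus corresponds to one step of the recursion.\<close>

lemma ord_succ_seg: "ord_succ seg_order I J \<longleftrightarrow> (\<exists>x. I = below x \<and> J = insert x (below x))"
proof
  assume *: "ord_succ seg_order I J"
  then have I: "seg I" and J: "seg J" by (simp_all add: ord_succ_def Field_seg_order)
  then have "{K. seg K \<and> K \<subset> J} = {K. seg K \<and> K \<subseteq> I}"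
    using * by (simp add: ord_succ_def under_seg_order)
  then have eq: "K \<subset> J \<longleftrightarrow> K \<subseteq> I" if "seg K" for K using that by blast
  obtain x where x: "x \<in> J" "x \<notin> I" using eq[OF I] by blast
  have "insert x (below x) = J"
    using eq[OF seg_insert_below[of x]] insert_below_subset[OF J x(1)] x(2) by blast
  moreover have "below x \<subseteq> I"
    using eq[OF seg_below[of x]] insert_below_subset[OF J x(1)] below_not_self x(1) by blast
  ultimately show "\<exists>x. I = below x \<and> J = insert x (below x)"
    using subset_below[OF I x(2)] by blast
next
  assume "\<exists>x. I = below x \<and> J = insert x (below x)"
  then obtain x where x: "I = below x" "J = insert x (below x)" by blast
  have "K \<subset> J \<longleftrightarrow> K \<subseteq> I" if K: "seg K" for K
    using insert_below_subset[OF K, of x] below_not_self[of x] x by blast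
  then show "ord_succ seg_order I J"
    using seg_below seg_insert_below
    by (auto simp: ord_succ_def Field_seg_order under_seg_order x)
qed

text \<open>At a limit every element already belongs to a strictly smaller segment ending in it,
  which is what continuity of the filtration needs.\<close>

lemma ord_limit_seg:
  assumes "ord_limit seg_order I"
  shows "I \<noteq> {}" and "x \<in> I \<Longrightarrow> insert x (below x) \<in> underS seg_order I"
proof -
  show "I \<noteq> {}" using assms by (auto simp: ord_limit_def ord_zero_seg)
  assume x: "x \<in> I"
  have I: "seg I" using assms by (auto simp: ord_limit_def Field_seg_order)
  have "insert x (below x) \<noteq> I" using assms by (auto simp: ord_limit_def ord_succ_seg)
  then show "insert x (below x) \<in> underS seg_order I"
    using I insert_below_subset[OF I x] seg_insert_below by (auto simp: under_seg_order)
qed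

text \<open>The least element yields the index 1 of the filtration, as the successor of the empty
  segment.\<close>

lemma least_exists: obtains x where "below x = {}"
proof -
  obtain x where "\<forall>y. (y, x) \<in> W - Id \<longrightarrow> y \<notin> UNIV"
    using W_wf[unfolded wf_eq_minimal, rule_format, of undefined UNIV] by blast
  then show thesis using that[of x] by (simp add: below_def)
qed

end

section \<open>The filtration\<close>

context projective_resolution
begin

definition countable_extension :: "(nat \<Rightarrow> 'p set) \<Rightarrow> (nat \<Rightarrow> 'p set) \<Rightarrow> bool" where
  "countable_extension A B \<longleftrightarrow> good A \<and> good B \<and> A \<le> B \<and>
     (\<forall>k. \<exists>T. T \<subseteq> carrier (P k) \<and> countable T \<and> B k = span k (A k \<union> T))"

abbreviation (input) trivial :: "nat \<Rightarrow> 'p set" where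
  "trivial \<equiv> \<lambda>k. {\<zero>\<^bsub>P k\<^esub>}"

lemma trivial_le: "good A \<Longrightarrow> trivial \<le> A"
  by (rule le_funI) (simp add: submodule_zero[OF goodD(1)])

lemma e_zero: "e \<zero>\<^bsub>P 0\<^esub> = \<zero>\<^bsub>M\<^esub>"
  by (rule left_module_hom_zero[OF module_P module_M e_hom])

lemma good_image: "good A \<Longrightarrow> submodule (e ` A 0) R M"
  by (rule submodule_image[OF module_P module_M e_hom goodD(1)])

lemma countable_extension_exists:
  assumes A: "good A" and X: "X \<subseteq> carrier M" "countable X"
  obtains B where "countable_extension A B" "X \<subseteq> e ` B 0"
proof -
  obtain S where S: "countable S" "S \<subseteq> carrier (P 0)" "X = e ` S"
    using X countable_subset_image[of X e "carrier (P 0)"] by (auto simp: e_surj)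
  obtain B T where B: "good B" "A \<le> B" "S \<subseteq> B 0"
    and T: "\<And>k. T k \<subseteq> carrier (P k)" "\<And>k. countable (T k)" "\<And>k. B k = span k (A k \<union> T k)"
    using good_extend[OF A S(2,1)] by blast
  have "\<exists>T. T \<subseteq> carrier (P k) \<and> countable T \<and> B k = span k (A k \<union> T)" for k
    using T[of k] by blast
  then have "countable_extension A B"
    using A B(1,2) by (simp add: countable_extension_def)
  then show thesis using that S(3) B(3) by blast
qed

lemma countable_extension_P_aleph0:
  assumes AB: "countable_extension A B" and fin: "carrier (P (Suc n)) = {\<zero>\<^bsub>P (Suc n)\<^esub>}"
    and Y: "left_module R Y" and \<psi>: "\<psi> \<in> left_module_hom R (M\<lparr>carrier := e ` B 0\<rparr>) Y"
    and \<psi>_surj: "\<psi> ` e ` B 0 = carrier Y"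
    and \<psi>_ker: "\<And>y. y \<in> e ` B 0 \<Longrightarrow> \<psi> y = \<zero>\<^bsub>Y\<^esub> \<longleftrightarrow> y \<in> e ` A 0"
  shows "P_aleph0 R n Y"
proof -
  have *: "good A" "good B" "A \<le> B"
    and ex: "\<forall>k. \<exists>T. T \<subseteq> carrier (P k) \<and> countable T \<and> B k = span k (A k \<union> T)"
    using AB by (simp_all add: countable_extension_def)
  obtain T where "\<forall>k. T k \<subseteq> carrier (P k) \<and> countable (T k) \<and> B k = span k (A k \<union> T k)"
    using choice[OF ex] by (elim exE)
  then have T: "\<And>k. T k \<subseteq> carrier (P k)" "\<And>k. countable (T k)" "\<And>k. B k = span k (A k \<union> T k)"
    by simp_all
  show ?thesis
    by (rule subquotient_P_aleph0[where T = T and A = A and B = B and \<psi> = \<psi>, OF * T fin Y \<psi> \<psi>_surj \<psi>_ker])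
qed

text \<open>The case of the identity as \<open>\<psi>\<close>. It serves for the zeroth stage, which
  is zero, and for the first stage as a module in its own right.\<close>

lemma P_aleph0_trivial_extension:
  assumes "countable_extension trivial B" and "carrier (P (Suc n)) = {\<zero>\<^bsub>P (Suc n)\<^esub>}"
  shows "P_aleph0 R n (M\<lparr>carrier := e ` B 0\<rparr>)"
proof -
  have B: "good B" using assms(1) by (simp add: countable_extension_def)
  show ?thesis
    by (rule countable_extension_P_aleph0[OF assms M.left_module_submodule[OF good_image[OF B]],
          where \<psi> = "\<lambda>x. x"])
      (auto simp: e_zero left_module_hom_def)
qed

lemma P_aleph0_extension_quotient:
  assumes AB: "countable_extension A B" and "carrier (P (Suc n)) = {\<zero>\<^bsub>P (Suc n)\<^esub>}"
  shows "P_aleph0 R n (quotient_module (M\<lparr>carrier := e ` B 0\<rparr>) (e ` A 0))"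
proof -
  have A: "good A" and B: "good B" and le: "A \<le> B"
    using assms(1) by (simp_all add: countable_extension_def)
  let ?L = "M\<lparr>carrier := e ` B 0\<rparr>"
  have L: "left_module R ?L" by (rule M.left_module_submodule[OF good_image[OF B]])
  have "e ` A 0 \<subseteq> e ` B 0" using le by (intro image_mono) (simp add: le_fun_def)
  then have N: "submodule (e ` A 0) R ?L"
    using good_image[OF A] by (simp add: M.submodule_of_submodule[OF good_image[OF B]])
  show ?thesis
    by (rule countable_extension_P_aleph0[OF assms left_module_quotient[OF L N] quotient_projection_hom[OF L N]])
      (use quotient_projection_surj[OF L N] quotient_projection_zero[OF L N] in simp_all)
qed

text \<open>The trivial family is included because an empty union of sets would not be a submodule.
  It lies below every good family, so it does not affect nonempty unions of good families.\<close>

definition tuple_union :: "('w \<Rightarrow> nat \<Rightarrow> 'p set) \<Rightarrow> 'w set \<Rightarrow> nat \<Rightarrow> 'p set" where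
  "tuple_union T I = (\<lambda>k. \<Union>A\<in>insert trivial (T ` I). A k)"

lemma good_tuple_union:
  assumes T: "\<And>x. x \<in> I \<Longrightarrow> good (T x)"
    and chain: "\<And>x y. \<lbrakk>x \<in> I; y \<in> I\<rbrakk> \<Longrightarrow> T x \<le> T y \<or> T y \<le> T x"
  shows "good (tuple_union T I)"
  unfolding tuple_union_def
proof (rule good_Union)
  show good: "good A" if "A \<in> insert trivial (T ` I)" for A
    using that T good_zero by auto
  fix A B assume A: "A \<in> insert trivial (T ` I)" and B: "B \<in> insert trivial (T ` I)"
  then consider "A = trivial" | "B = trivial" | x y where "x \<in> I" "y \<in> I" "A = T x" "B = T y"
    by blast
  then show "A \<le> B \<or> B \<le> A"
    by cases (use trivial_le[OF good[OF A]] trivial_le[OF good[OF B]] chain in auto)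
qed simp

lemma tuple_union_upper: "x \<in> I \<Longrightarrow> T x \<le> tuple_union T I"
  by (auto simp: le_fun_def tuple_union_def)

lemma tuple_union_mono: "I \<subseteq> J \<Longrightarrow> tuple_union T I \<le> tuple_union T J"
  by (auto simp: le_fun_def tuple_union_def)

lemma tuple_union_empty: "tuple_union T {} = trivial"
  by (simp add: tuple_union_def)

lemma tuple_union_least: "good B \<Longrightarrow> (\<And>x. x \<in> I \<Longrightarrow> T x \<le> B) \<Longrightarrow> tuple_union T I \<le> B"
proof (rule le_funI)
  fix k assume B: "good B" and T: "\<And>x. x \<in> I \<Longrightarrow> T x \<le> B"
  have "A k \<subseteq> B k" if A: "A \<in> insert trivial (T ` I)" for A
  proof -
    have "A \<le> B" using A T trivial_le[OF B] by auto
    then show ?thesis by (rule le_funD)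
  qed
  then show "tuple_union T I k \<subseteq> B k" unfolding tuple_union_def by (rule UN_least)
qed

lemma filtration_exists:
  assumes fin: "carrier (P (Suc n)) = {\<zero>\<^bsub>P (Suc n)\<^esub>}"
    and X: "X \<subseteq> carrier M" "countable X"
  shows "\<exists>(r :: 'm set rel) (F :: 'm set \<Rightarrow> 'm set) i\<^sub>0 i\<^sub>1.
    P_aleph0_filtration R n M r F \<and> ord_zero r i\<^sub>0 \<and> ord_succ r i\<^sub>0 i\<^sub>1 \<and>
    P_aleph0 R n (M\<lparr>carrier := F i\<^sub>1\<rparr>) \<and> submodule (F i\<^sub>1) R M \<and> X \<subseteq> F i\<^sub>1"
proof -
  obtain W :: "'m rel" where W: "Well_order W" "Field W = UNIV"
    using well_ordering[where 'a = 'm] by (elim exE conjE)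
  interpret segments W using W by (rule segments.intro)
  \<comment> \<open>Adding x at step x makes the filtration exhaust \<open>M\<close>; adding
    \<open>X\<close> at every step puts it into the first one. The intersection is needed because
    \<open>W\<close> well-orders the whole type, including elements outside
    \<open>M\<close>.\<close>
  define ext where "ext x A B \<longleftrightarrow> countable_extension A B \<and> insert x X \<inter> carrier M \<subseteq> e ` B 0" for x A B
  define step where "step x A = (SOME B. ext x A B)" for x A
  have step: "ext x A (step x A)" if A: "good A" for x A
  proof -
    have "countable (insert x X \<inter> carrier M)" using X(2) by simp
    then obtain B where "countable_extension A B" "insert x X \<inter> carrier M \<subseteq> e ` B 0"
      by (rule countable_extension_exists[OF A Int_lower2])
    then have "\<exists>B. ext x A B" unfolding ext_def by blast
    then show ?thesis unfolding step_def by (rule someI_ex)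
  qed
  define T where "T = wfrec (W - Id) (\<lambda>T x. step x (tuple_union T (below x)))"
  have T: "T x = step x (tuple_union T (below x))" for x
  proof -
    have "T x = step x (tuple_union (cut T (W - Id) x) (below x))"
      unfolding T_def by (rule wfrec[OF W_wf])
    also have "tuple_union (cut T (W - Id) x) (below x) = tuple_union T (below x)"
      unfolding tuple_union_def by (simp add: below_def cut_def)
    finally show ?thesis .
  qed
  \<comment> \<open>Goodness and monotonicity are proved together: the union of the earlier steps is
    known to be good only when these form a chain.\<close>
  have good_T: "good (T x) \<and> (\<forall>y\<in>below x. T y \<le> T x)" for x
    using W_wf
  proof (induction x rule: wf_induct_rule)
    case (less x)
    have "good (tuple_union T (below x))"
    proof (rule good_tuple_union)
      show "good (T y)" if "y \<in> below x" for y using less that by (simp add: below_def)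
      show "T y \<le> T z \<or> T z \<le> T y" if yz: "y \<in> below x" "z \<in> below x" for y z
      proof -
        have "y = z \<or> y \<in> below z \<or> z \<in> below y" using W_total[of y z] by (auto simp: below_def)
        then show ?thesis using less[of y] less[of z] yz by (auto simp: below_def)
      qed
    qed
    then have "countable_extension (tuple_union T (below x)) (T x)"
      using step[of "tuple_union T (below x)" x] by (simp add: ext_def T[symmetric])
    then have good: "good (T x)" and le: "tuple_union T (below x) \<le> T x"
      by (simp_all add: countable_extension_def)
    show ?case
    proof (intro conjI ballI)
      show "T y \<le> T x" if "y \<in> below x" for y
        using tuple_union_upper[of y "below x" T, OF that] le by (rule order_trans)
    qed (rule good)
  qed
  have good_U: "good (tuple_union T I)" for I
  proof (rule good_tuple_union)
    show "T y \<le> T z \<or> T z \<le> T y" for y z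
      using W_total[of y z] good_T[of y] good_T[of z] by (cases "y = z") (auto simp: below_def)
  qed (simp add: good_T)
  have ext_T: "ext x (tuple_union T (below x)) (T x)" for x
    by (subst T) (rule step[OF good_U])
  \<comment> \<open>The steps increase, so the stage that ends with x is the step at x itself; a
    successor step of the filtration is therefore one countable extension.\<close>
  have U_insert: "tuple_union T (insert x (below x)) = T x" for x
  proof (rule antisym)
    show "tuple_union T (insert x (below x)) \<le> T x" by (rule tuple_union_least) (use good_T[of x] in auto)
    show "T x \<le> tuple_union T (insert x (below x))" by (rule tuple_union_upper) simp
  qed
  define F where "F I = e ` tuple_union T I 0" for I
  have F_mono: "F I \<subseteq> F J" if "I \<subseteq> J" for I J
    unfolding F_def using tuple_union_mono[OF that] by (intro image_mono) (simp add: le_fun_def)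
  have F_sub: "submodule (F I) R M" for I unfolding F_def by (rule good_image[OF good_U])
  have F_zero: "F {} = {\<zero>\<^bsub>M\<^esub>}" by (simp add: F_def tuple_union_empty e_zero)
  have F_T: "F (insert x (below x)) = e ` T x 0" for x by (simp add: F_def U_insert)
  have F_ext: "countable_extension (tuple_union T (below x)) (tuple_union T (insert x (below x)))"
    "insert x X \<inter> carrier M \<subseteq> F (insert x (below x))" for x
    using ext_T[of x] by (simp_all add: ext_def U_insert F_T)
  have F_limit: "F I = (\<Union>J\<in>underS seg_order I. F J)" if lim: "ord_limit seg_order I" for I
  proof
    show "(\<Union>J\<in>underS seg_order I. F J) \<subseteq> F I"
      by (rule UN_least, rule F_mono) (simp add: underS_def seg_order_def)
    obtain x where "x \<in> I" using ord_limit_seg(1)[OF lim] by blast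
    then have ne: "F (insert x (below x)) \<subseteq> (\<Union>J\<in>underS seg_order I. F J)"
      by (intro UN_upper ord_limit_seg(2)[OF lim])
    show "F I \<subseteq> (\<Union>J\<in>underS seg_order I. F J)"
    proof
      fix z assume "z \<in> F I"
      then obtain p where p: "p \<in> tuple_union T I 0" "z = e p" by (auto simp: F_def)
      \<comment> \<open>The first case comes from the trivial family in the union; the zero then
        lies in any of the earlier stages, and one exists because a limit segment is
        nonempty.\<close>
      then consider "p = \<zero>\<^bsub>P 0\<^esub>" | y where "y \<in> I" "p \<in> T y 0" by (auto simp: tuple_union_def)
      then show "z \<in> (\<Union>J\<in>underS seg_order I. F J)"
      proof cases
        case 1
        then show ?thesis using ne submodule_zero[OF F_sub] p(2) e_zero by auto
      next
        case (2 y)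
        then have "z \<in> F (insert y (below y))" using p(2) by (simp add: F_T)
        then show ?thesis using ord_limit_seg(2)[OF lim \<open>y \<in> I\<close>] by blast
      qed
    qed
  qed
  have F_all: "carrier M = (\<Union>I\<in>Field seg_order. F I)"
  proof
    show "(\<Union>I\<in>Field seg_order. F I) \<subseteq> carrier M" using submodule_subset[OF F_sub] by blast
    show "carrier M \<subseteq> (\<Union>I\<in>Field seg_order. F I)"
    proof
      fix x assume "x \<in> carrier M"
      then have "x \<in> F (insert x (below x))" using F_ext(2)[of x] by blast
      then show "x \<in> (\<Union>I\<in>Field seg_order. F I)"
        using seg_insert_below[of x] by (auto simp: Field_seg_order)
    qed
  qed
  \<comment> \<open>The zero family extends itself by no generators at all, which puts the zero
    module at index 0 into the class.\<close>
  have trivial_ext: "countable_extension trivial trivial"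
  proof -
    have "trivial k = span k (trivial k \<union> {})" for k
      by (simp add: hull_same P.submodule_zero_set)
    then show ?thesis
      unfolding countable_extension_def using good_zero by (metis countable_empty empty_subsetI order_refl)
  qed
  obtain x where x: "below x = {}" using least_exists by blast
  show ?thesis
  proof (intro exI conjI)
    show "P_aleph0_filtration R n M seg_order F"
      unfolding P_aleph0_filtration_def
    proof (intro conjI allI impI ballI)
      show "Well_order seg_order" by (rule Well_order_seg_order)
      show "Field seg_order \<noteq> {}" using seg_below by (auto simp: Field_seg_order)
      show "case z of (I, J) \<Rightarrow> F I \<subseteq> F J" if "z \<in> seg_order" for z
        using that F_mono by (auto simp: seg_order_def)
      show "P_aleph0 R n (M\<lparr>carrier := F I\<rparr>)" if "ord_zero seg_order I" for I
        using that P_aleph0_trivial_extension[OF trivial_ext fin]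
        by (simp add: ord_zero_seg F_zero e_zero)
      show "P_aleph0 R n (quotient_module (M\<lparr>carrier := F J\<rparr>) (F I))" if "ord_succ seg_order I J" for I J
        using that P_aleph0_extension_quotient[OF F_ext(1) fin] by (auto simp: ord_succ_seg F_def)
    qed (use F_sub F_limit F_all in auto)
    show "ord_zero seg_order {}" by (simp add: ord_zero_seg)
    \<comment> \<open>Since nothing is below x, the stage at \<open>{x}\<close> is the first step of
      the recursion, a countable extension of the trivial family.\<close>
    show "ord_succ seg_order {} {x}" unfolding ord_succ_seg by (rule exI[of _ x]) (simp add: x)
    show "submodule (F {x}) R M" by (rule F_sub)
    show "X \<subseteq> F {x}" using F_ext(2)[of x] X(1) by (auto simp: x)
    show "P_aleph0 R n (M\<lparr>carrier := F {x}\<rparr>)"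
      using P_aleph0_trivial_extension[OF _ fin] F_ext(1)[of x] by (simp add: x tuple_union_empty F_def)
  qed
qed

end

section \<open>From a finite resolution to one indexed by all degrees\<close>

lemma projective_zero_module:
  fixes P :: "('a, 'p) module"
  assumes P: "projective_module R P"
  shows "projective_module R (P\<lparr>carrier := {\<zero>\<^bsub>P\<^esub>}\<rparr>)"
proof -
  interpret left_module R P using P by (simp add: projective_module_def)
  show ?thesis
    by (rule projective_retract[OF P left_module_submodule[OF submodule_zero_set],
          where f = "\<lambda>_. \<zero>\<^bsub>P\<^esub>" and g = "\<lambda>x. x"])
      (simp_all add: left_module_hom_def smult_r_zero)
qed

lemma resolution_extension:
  fixes P :: "nat \<Rightarrow> ('a, 'p) module" and M :: "('a, 'm) module"
  assumes noeth: "left_noetherian R" and P: "\<And>k. k \<le> n \<Longrightarrow> projective_module R (P k)"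
    and res: "resolution R n P d e M"
  obtains P' :: "nat \<Rightarrow> ('a, 'p) module" and d' supp where
    "projective_resolution R P' d' e M supp" "carrier (P' (Suc n)) = {\<zero>\<^bsub>P' (Suc n)\<^esub>}"
proof -
  have M: "left_module R M"
    and e: "e \<in> left_module_hom R (P 0) M" "e ` carrier (P 0) = carrier M"
    and d: "\<And>k. k < n \<Longrightarrow> d k \<in> left_module_hom R (P (Suc k)) (P k)"
    and ex: "\<And>k. k \<le> n \<Longrightarrow> (if k < n then d k ` carrier (P (Suc k)) else {\<zero>\<^bsub>P k\<^esub>}) =
        (case k of 0 \<Rightarrow> a_kernel (P 0) M e | Suc j \<Rightarrow> a_kernel (P k) (P j) (d j))"
    using res by (simp_all add: resolution_def)
  \<comment> \<open>The zero module must have its carrier in the type of the other terms; the zero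
    of \<open>P 0\<close> supplies an element for it.\<close>
  define P' where "P' k = (if k \<le> n then P k else P 0\<lparr>carrier := {\<zero>\<^bsub>P 0\<^esub>}\<rparr>)" for k
  define d' where "d' k = (if k < n then d k else (\<lambda>_. \<zero>\<^bsub>P' k\<^esub>))" for k
  have P'_le: "P' k = P k" if "k \<le> n" for k using that by (simp add: P'_def)
  have P'_gt: "carrier (P' k) = {\<zero>\<^bsub>P' k\<^esub>}" if "k > n" for k using that by (simp add: P'_def)
  have d'_lt: "d' k = d k" if "k < n" for k using that by (simp add: d'_def)
  have proj: "projective_module R (P' k)" for k
    using P projective_zero_module[OF P[of 0]] by (simp add: P'_def)
  have mod: "left_module R (P' k)" for k using proj[of k] by (simp add: projective_module_def)
  have d'_hom: "d' k \<in> left_module_hom R (P' (Suc k)) (P' k)" for k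
  proof (cases "k < n")
    case True
    then show ?thesis using d by (simp add: d'_lt P'_le)
  next
    case False
    interpret Q: left_module R "P' k" by (rule mod)
    from False show ?thesis by (simp add: d'_def left_module_hom_def Q.smult_r_zero)
  qed
  have image: "d' k ` carrier (P' (Suc k)) = (if k < n then d k ` carrier (P (Suc k)) else {\<zero>\<^bsub>P' k\<^esub>})" for k
  proof (cases "k < n")
    case True
    then show ?thesis by (simp add: d'_lt P'_le)
  next
    case False
    then show ?thesis by (simp add: d'_def P'_gt)
  qed
  have image_le: "d' k ` carrier (P' (Suc k)) = (if k < n then d k ` carrier (P (Suc k)) else {\<zero>\<^bsub>P k\<^esub>})"
    if "k \<le> n" for k
    using that by (simp add: image P'_le)
  have exact_0: "d' 0 ` carrier (P' (Suc 0)) = {x \<in> carrier (P' 0). e x = \<zero>\<^bsub>M\<^esub>}"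
    using ex[of 0] by (simp add: image_le P'_le a_kernel_def' split del: if_split)
  have exact_Suc: "d' (Suc k) ` carrier (P' (Suc (Suc k))) = {x \<in> carrier (P' (Suc k)). d' k x = \<zero>\<^bsub>P' k\<^esub>}" for k
  proof (cases "Suc k \<le> n")
    case True
    then show ?thesis using ex[of "Suc k"] 
      by (simp add: image_le P'_le d'_lt a_kernel_def' split del: if_split)
  \<comment> \<open>Here k + 1 exceeds n, and both sides consist of zero only. The case k + 1 = n
    falls under the other branch, where the image of the padded zero map expresses injectivity of
    the last differential.\<close>
  next
    case False
    then show ?thesis
      using left_module_hom_zero[OF mod mod d'_hom] by (auto simp: P'_gt)
  qed
  have "\<forall>k. \<exists>supp. support_function R (P' k) supp" using projective_support[OF proj] by blast
  then obtain supp where supp: "\<forall>k. support_function R (P' k) (supp k)" by (elim choice[THEN exE])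
  have "projective_resolution R P' d' e M supp"
  proof (rule projective_resolution.intro)
    show "e \<in> left_module_hom R (P' 0) M" "e ` carrier (P' 0) = carrier M" using e by (simp_all add: P'_le)
  qed (simp_all add: noeth M proj d'_hom exact_0 exact_Suc supp)
  then show thesis by (rule that) (simp add: P'_gt)
qed

theorem proposition5p1:
  fixes R :: "('a, 'r) ring_scheme" and M :: "('a, 'm) module" and N :: "'m set" and n :: nat
  assumes "left_right_noetherian_ring R"
    and "n > 0"
    and "left_module R M"
    and "proj_dim_le TYPE('p) R n M"
    and "submodule N R M"
    and "countably_generated R (M\<lparr>carrier := N\<rparr>)"
  shows "\<exists>(r :: 'm set rel) (F :: 'm set \<Rightarrow> 'm set) i\<^sub>0 i\<^sub>1.
    P_aleph0_filtration R n M r F \<and>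
    ord_zero r i\<^sub>0 \<and> ord_succ r i\<^sub>0 i\<^sub>1 \<and>
    P_aleph0 R n (M\<lparr>carrier := F i\<^sub>1\<rparr>) \<and> N \<subseteq> F i\<^sub>1"
proof -
  interpret M: left_module R M by fact
  have noeth: "left_noetherian R" using assms(1) by (simp add: left_right_noetherian_ring_def)
  obtain P :: "nat \<Rightarrow> ('a, 'p) module" and d e
    where P: "\<forall>k\<le>n. projective_module R (P k)" and res: "resolution R n P d e M"
    using assms(4) unfolding proj_dim_le_def by (elim exE conjE)
  obtain P' :: "nat \<Rightarrow> ('a, 'p) module" and d' supp
    where "projective_resolution R P' d' e M supp"
      and fin: "carrier (P' (Suc n)) = {\<zero>\<^bsub>P' (Suc n)\<^esub>}"
    using resolution_extension[OF noeth P[rule_format] res] .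
  then interpret projective_resolution R P' d' e M supp by simp
  obtain X where X: "X \<subseteq> N" "countable X" and gen: "(\<lambda>H. submodule H R M) hull X = N"
    using assms(6) by (auto simp: countably_generated_def M.hull_submodule_eq[OF assms(5)])
  have "X \<subseteq> carrier M" using X(1) submodule_subset[OF assms(5)] by blast
  from filtration_exists[OF fin this X(2)] obtain r :: "'m set rel" and F :: "'m set \<Rightarrow> 'm set" and i\<^sub>0 i\<^sub>1
    where F: "P_aleph0_filtration R n M r F" "ord_zero r i\<^sub>0" "ord_succ r i\<^sub>0 i\<^sub>1"
      "P_aleph0 R n (M\<lparr>carrier := F i\<^sub>1\<rparr>)" "submodule (F i\<^sub>1) R M" "X \<subseteq> F i\<^sub>1"
    by (elim exE conjE)
  \<comment> \<open>Absorbing the generators is enough, because the first stage is a submodule of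
    \<open>M\<close>.\<close>
  have "N \<subseteq> F i\<^sub>1" unfolding gen[symmetric] using F(6,5) by (rule hull_minimal)
  with F(1-4) show ?thesis by blast
qed

end
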